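(* The category $\mathcal{N}ec$ of necklaces, equipped with $\mathcal{N}ec^{\leftarrow}=\{\text{epimorphisms}\}$, $\mathcal{N}ec^{\to}=\{\text{monomorphisms}\}$ and the degree function $\deg X=(\dim X,\ell(X))\in\mathbb{N}\times\mathbb{N}$ (with $\mathbb{N}\times\mathbb{N}$ ordered lexicographically, i.e. identified with the ordinal $\omega^2$), is a Reedy category.
   Context: A Reedy structure on a small category $\mathcal{R}$ consists of wide subcategories $\mathcal{R}^{\leftarrow}$ (inverse) and $\mathcal{R}^{\to}$ (direct) and a degree function $\deg:\mathrm{Ob}(\mathcal{R})\to\lambda$ with $\lambda$ an ordinal, such that every morphism $f$ factors uniquely as $f=f^{\to}\circ f^{\leftarrow}$ with $f^{\to}\in\mathcal{R}^{\to}$, $f^{\leftarrow}\in\mathcal{R}^{\leftarrow}$, every non-identity morphism of $\mathcal{R}^{\leftarrow}$ lowers the degree, and every non-identity morphism of $\mathcal{R}^{\to}$ raises the degree. A small category with a Reedy structure is a Reedy category. Let $\mathrm{SSet}_{*,*}=(\partial\Delta^1/\mathrm{SSet})$ be the category of bipointed simplicial sets, with wedge $(X,x_0,x_1)\vee(Y,y_0,y_1)=(X\amalg_{x_1=y_0}Y,x_0,y_1)$ and unit $\Delta^0$; $\Delta^n$ is bipointed at $0$ and $n$. The category $\mathcal{N}ec$ of necklaces is the full subcategory of $\mathrm{SSet}_{*,*}$ on the objects $X=\Delta^{n_1}\vee\cdots\vee\Delta^{n_k}$ with $k\geq 0$, $n_i>0$ (for $k=0$ this is $\Delta^0$). The bead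 length is $\ell(X)=k$, the spine length is $\|X\|=n_1+\cdots+n_k$, and the dimension is $\dim X=\|X\|-\ell(X)$. Let $\mathbf{\Delta}_f\subseteq\mathbf{\Delta}$ be the subcategory of the simplex category with all objects and the morphisms $f:[m]\to[n]$ with $f(0)=0$, $f(m)=n$. $\mathcal{N}ec$ is identified, via an equivalence of categories, with the category whose objects are pairs $(T,p)$ with $p\geq 0$, $\{0,p\}\subseteq T\subseteq[p]$, whose morphisms $(T,p)\to(S,q)$ are the $f:[p]\to[q]$ in $\mathbf{\Delta}_f$ with $S\subseteq f(T)$, and with composition as in $\mathbf{\Delta}_f$; the pair $(\{0=t_0<\cdots<t_k=p\},p)$ corresponds to $\Delta^{t_1-t_0}\vee\cdots\vee\Delta^{t_k-t_{k-1}}$. Monomorphism and epimorphism refer to the underlying maps in $\mathrm{SSet}_{*,*}$, i.e. $f$ is a monomorphism (epimorphism) if $f_n$ is injective (surjective) for all $n\geq 0$. *)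

theory Defs
  imports "HOL-Library.FuncSet" "HOL-Library.Product_Lexorder"
begin

section \<open>Categories and Reedy structures\<close>

record ('o, 'm) cat =
  Obj :: "'o set"
  Arr :: "'m set"
  Dom :: "'m \<Rightarrow> 'o"
  Cod :: "'m \<Rightarrow> 'o"
  Id :: "'o \<Rightarrow> 'm"
  Comp :: "'m \<Rightarrow> 'm \<Rightarrow> 'm"

text \<open>\<open>Comp C g f\<close> is \<open>g \<circ> f\<close> and is only meaningful if \<open>Cod C f = Dom C g\<close>.\<close>

locale category =
  fixes C :: "('o, 'm) cat"
  assumes Dom_Obj: "f \<in> Arr C \<Longrightarrow> Dom C f \<in> Obj C"
    and Cod_Obj: "f \<in> Arr C \<Longrightarrow> Cod C f \<in> Obj C"
    and Id_Arr: "a \<in> Obj C \<Longrightarrow> Id C a \<in> Arr C"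
    and Dom_Id: "a \<in> Obj C \<Longrightarrow> Dom C (Id C a) = a"
    and Cod_Id: "a \<in> Obj C \<Longrightarrow> Cod C (Id C a) = a"
    and Comp_Arr: "\<lbrakk>f \<in> Arr C; g \<in> Arr C; Cod C f = Dom C g\<rbrakk> \<Longrightarrow> Comp C g f \<in> Arr C"
    and Dom_Comp: "\<lbrakk>f \<in> Arr C; g \<in> Arr C; Cod C f = Dom C g\<rbrakk> \<Longrightarrow> Dom C (Comp C g f) = Dom C f"
    and Cod_Comp: "\<lbrakk>f \<in> Arr C; g \<in> Arr C; Cod C f = Dom C g\<rbrakk> \<Longrightarrow> Cod C (Comp C g f) = Cod C g"
    and Comp_Id_right: "f \<in> Arr C \<Longrightarrow> Comp C f (Id C (Dom C f)) = f"
    and Comp_Id_left: "f \<in> Arr C \<Longrightarrow> Comp C (Id C (Cod C f)) f = f"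
    and Comp_assoc: "\<lbrakk>f \<in> Arr C; g \<in> Arr C; h \<in> Arr C; Cod C f = Dom C g; Cod C g = Dom C h\<rbrakk>
      \<Longrightarrow> Comp C h (Comp C g f) = Comp C (Comp C h g) f"

text \<open>A wide subcategory is given by its set of arrows.\<close>

locale wide_subcategory = category C
  for C :: "('o, 'm) cat" and S :: "'m set" +
  assumes sub_Arr: "S \<subseteq> Arr C"
    and sub_Id: "a \<in> Obj C \<Longrightarrow> Id C a \<in> S"
    and sub_Comp: "\<lbrakk>f \<in> S; g \<in> S; Cod C f = Dom C g\<rbrakk> \<Longrightarrow> Comp C g f \<in> S"

text \<open>The ordinal in which the degree takes its values is a well-ordered type.\<close>

locale reedy_category =
  category C + inverse: wide_subcategory C Inv + direct: wide_subcategory C Dir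
  for C :: "('o, 'm) cat" and Inv :: "'m set" and Dir :: "'m set"
    and deg :: "'o \<Rightarrow> 'd :: wellorder" +
  assumes unique_factorization:
      "f \<in> Arr C \<Longrightarrow>
        \<exists>!(g, h). g \<in> Dir \<and> h \<in> Inv \<and> Cod C h = Dom C g \<and> f = Comp C g h"
    and inverse_lowers:
      "\<lbrakk>f \<in> Inv; f \<noteq> Id C (Dom C f)\<rbrakk> \<Longrightarrow> deg (Cod C f) < deg (Dom C f)"
    and direct_raises:
      "\<lbrakk>f \<in> Dir; f \<noteq> Id C (Dom C f)\<rbrakk> \<Longrightarrow> deg (Dom C f) < deg (Cod C f)"


section \<open>Simplicial sets\<close>

text \<open>Morphisms \<open>[m] \<rightarrow> [n]\<close> of the simplex category, as extensional functions.\<close>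

definition Delta :: "nat \<Rightarrow> nat \<Rightarrow> (nat \<Rightarrow> nat) set" where
  "Delta m n = {\<theta> \<in> {..m} \<rightarrow>\<^sub>E {..n}. mono_on {..m} \<theta>}"

text \<open>\<open>sact X m n \<theta>\<close> is the map \<open>X\<^sub>n \<rightarrow> X\<^sub>m\<close> induced by \<open>\<theta> : [m] \<rightarrow> [n]\<close>.\<close>

record 'a sset =
  simplices :: "nat \<Rightarrow> 'a set"
  sact :: "nat \<Rightarrow> nat \<Rightarrow> (nat \<Rightarrow> nat) \<Rightarrow> 'a \<Rightarrow> 'a"

definition is_sset :: "('a, 'z) sset_scheme \<Rightarrow> bool" where
  "is_sset X \<longleftrightarrow>
    (\<forall>m n. \<forall>\<theta> \<in> Delta m n. \<forall>x \<in> simplices X n. sact X m n \<theta> x \<in> simplices X m) \<and>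
    (\<forall>n. \<forall>x \<in> simplices X n. sact X n n (\<lambda>i\<in>{..n}. i) x = x) \<and>
    (\<forall>k m n. \<forall>\<phi> \<in> Delta k m. \<forall>\<theta> \<in> Delta m n. \<forall>x \<in> simplices X n.
      sact X k n (compose {..k} \<theta> \<phi>) x = sact X k m \<phi> (sact X m n \<theta> x))"

definition sset_hom ::
  "('a, 'y) sset_scheme \<Rightarrow> ('b, 'z) sset_scheme \<Rightarrow> (nat \<Rightarrow> 'a \<Rightarrow> 'b) set" where
  "sset_hom X Y = {f.
    (\<forall>n. f n \<in> simplices X n \<rightarrow>\<^sub>E simplices Y n) \<and>
    (\<forall>m n. \<forall>\<theta> \<in> Delta m n. \<forall>x \<in> simplices X n.
      f m (sact X m n \<theta> x) = sact Y m n \<theta> (f n x))}"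

definition sset_mono :: "('a, 'y) sset_scheme \<Rightarrow> (nat \<Rightarrow> 'a \<Rightarrow> 'b) \<Rightarrow> bool" where
  "sset_mono X f \<longleftrightarrow> (\<forall>n. inj_on (f n) (simplices X n))"

definition sset_epi ::
  "('a, 'y) sset_scheme \<Rightarrow> ('b, 'z) sset_scheme \<Rightarrow> (nat \<Rightarrow> 'a \<Rightarrow> 'b) \<Rightarrow> bool" where
  "sset_epi X Y f \<longleftrightarrow> (\<forall>n. f n ` simplices X n = simplices Y n)"


section \<open>Bipointed simplicial sets and wedges\<close>

text \<open>A map \<open>\<partial>\<Delta>\<^sup>1 \<rightarrow> X\<close> is a pair of vertices of \<open>X\<close>.\<close>

record 'a bsset = "'a sset" +
  pt0 :: 'a
  pt1 :: 'a

definition is_bsset :: "'a bsset \<Rightarrow> bool" where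
  "is_bsset X \<longleftrightarrow> is_sset X \<and> pt0 X \<in> simplices X 0 \<and> pt1 X \<in> simplices X 0"

definition bsset_hom :: "'a bsset \<Rightarrow> 'b bsset \<Rightarrow> (nat \<Rightarrow> 'a \<Rightarrow> 'b) set" where
  "bsset_hom X Y = {f \<in> sset_hom X Y. f 0 (pt0 X) = pt0 Y \<and> f 0 (pt1 X) = pt1 Y}"

text \<open>The \<open>n\<close>-simplex obtained from a vertex by iterated degeneracy.\<close>

definition degen :: "('a, 'z) sset_scheme \<Rightarrow> nat \<Rightarrow> 'a \<Rightarrow> 'a" where
  "degen X n v = sact X n 0 (\<lambda>i\<in>{..n}. 0) v"

text \<open>A type closed under binary sums, so that wedges can be iterated without changing the type
  of simplices.\<close>

datatype simplex = Base (the_Base: "nat \<Rightarrow> nat") | InL simplex | InR simplex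

definition std_simplex :: "nat \<Rightarrow> simplex bsset" where
  "std_simplex n = \<lparr>
    simplices = (\<lambda>m. Base ` Delta m n),
    sact = (\<lambda>k m \<theta> x. Base (compose {..k} (the_Base x) \<theta>)),
    pt0 = Base (\<lambda>i\<in>{..0}. 0),
    pt1 = Base (\<lambda>i\<in>{..0}. n)\<rparr>"

text \<open>The pushout \<open>X \<amalg> Y\<close> over \<open>x\<^sub>1 = y\<^sub>0\<close>: in each level the simplex of \<open>Y\<close> lying over \<open>y\<^sub>0\<close>
  is represented by the simplex of \<open>X\<close> lying over \<open>x\<^sub>1\<close>; \<open>wedge_inr\<close> is the resulting
  coprojection from \<open>Y\<close>. The universal property is \<open>wedge_pushout\<close> below.\<close>

definition wedge_inr :: "simplex bsset \<Rightarrow> simplex bsset \<Rightarrow> nat \<Rightarrow> simplex \<Rightarrow> simplex" where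
  "wedge_inr X Y n y =
    (if y = degen Y n (pt0 Y) then InL (degen X n (pt1 X)) else InR y)"

definition wedge :: "simplex bsset \<Rightarrow> simplex bsset \<Rightarrow> simplex bsset" where
  "wedge X Y = \<lparr>
    simplices = (\<lambda>n. InL ` simplices X n \<union> wedge_inr X Y n ` simplices Y n),
    sact = (\<lambda>m n \<theta> z. case z of
        InL x \<Rightarrow> InL (sact X m n \<theta> x)
      | InR y \<Rightarrow> wedge_inr X Y m (sact Y m n \<theta> y)
      | Base _ \<Rightarrow> undefined),
    pt0 = InL (pt0 X),
    pt1 = wedge_inr X Y 0 (pt1 Y)\<rparr>"

lemma Delta_const: "(\<lambda>i\<in>{..m}. 0) \<in> Delta m n"
  by (auto simp: Delta_def mono_on_def)

lemma Delta_0: "\<theta> \<in> Delta m 0 \<Longrightarrow> \<theta> = (\<lambda>i\<in>{..m}. 0)"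
  by (auto simp: Delta_def fun_eq_iff PiE_def extensional_def restrict_def Pi_def)

lemma Delta_comp: "\<phi> \<in> Delta k m \<Longrightarrow> \<theta> \<in> Delta m n \<Longrightarrow> compose {..k} \<theta> \<phi> \<in> Delta k n"
  by (fastforce simp: Delta_def PiE_def Pi_def compose_def mono_on_def)

lemma Delta_id: "(\<lambda>i\<in>{..n}. i) \<in> Delta n n"
  by (auto simp: Delta_def mono_on_def)

lemma is_bsset_std_simplex: "is_bsset (std_simplex n)"
proof -
  have "compose {..k} (compose {..m} x \<theta>) \<phi> = compose {..k} x (compose {..k} \<theta> \<phi>)"
    if "\<phi> \<in> Delta k m" for k m and x \<theta> \<phi> :: "nat \<Rightarrow> nat"
    using that by (auto simp: Delta_def compose_def fun_eq_iff PiE_def Pi_def)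
  moreover have "compose {..m} x (\<lambda>i\<in>{..m}. i) = x" if "x \<in> Delta m n" for m x
    using that by (auto simp: Delta_def compose_def fun_eq_iff PiE_def extensional_def)
  moreover have "(\<lambda>i\<in>{..0}. n) \<in> Delta 0 n"
    by (auto simp: Delta_def mono_on_def)
  ultimately show ?thesis
    using Delta_const[of 0 n]
    by (auto simp: is_bsset_def is_sset_def std_simplex_def Delta_comp)
qed

lemma sact_degen:
  assumes "is_sset X" "v \<in> simplices X 0" "\<theta> \<in> Delta m n"
  shows "sact X m n \<theta> (degen X n v) = degen X m v"
proof -
  have c: "compose {..m} (\<lambda>i\<in>{..n}. 0 :: nat) \<theta> = (\<lambda>i\<in>{..m}. 0)"
    using Delta_comp[OF assms(3) Delta_const[of n 0]] by (rule Delta_0)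
  have "(\<lambda>i\<in>{..n}. 0) \<in> Delta n 0"
    by (rule Delta_const)
  then have "sact X m 0 (compose {..m} (\<lambda>i\<in>{..n}. 0) \<theta>) v
      = sact X m n \<theta> (sact X n 0 (\<lambda>i\<in>{..n}. 0) v)"
    using assms unfolding is_sset_def by blast
  then show ?thesis
    by (simp add: degen_def c)
qed

lemma degen_0:
  assumes "is_sset X" "v \<in> simplices X 0"
  shows "degen X 0 v = v"
proof -
  have eq: "(\<lambda>i\<in>{..0::nat}. 0::nat) = (\<lambda>i\<in>{..0}. i)" by auto
  have "sact X 0 0 (\<lambda>i\<in>{..0}. i) v = v"
    using assms unfolding is_sset_def by blast
  then show ?thesis by (simp only: degen_def eq)
qed

lemma hom_degen:
  assumes "f \<in> sset_hom X Y" "v \<in> simplices X 0"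
  shows "f n (degen X n v) = degen Y n (f 0 v)"
  using assms Delta_const[of n 0] unfolding sset_hom_def degen_def by blast

lemma sact_wedge_inl: "sact (wedge X Y) m n \<theta> (InL x) = InL (sact X m n \<theta> x)"
  by (simp add: wedge_def)

lemma sact_wedge_inr:
  assumes "is_bsset X" "is_bsset Y" "\<theta> \<in> Delta m n" "y \<in> simplices Y n"
  shows "sact (wedge X Y) m n \<theta> (wedge_inr X Y n y) = wedge_inr X Y m (sact Y m n \<theta> y)"
  using assms sact_degen[of X "pt1 X" \<theta> m n] sact_degen[of Y "pt0 Y" \<theta> m n]
  by (auto simp: wedge_def wedge_inr_def is_bsset_def)

lemma simplices_wedge:
  "simplices (wedge X Y) n = InL ` simplices X n \<union> wedge_inr X Y n ` simplices Y n"
  by (simp add: wedge_def)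

lemma is_bsset_wedge:
  assumes X: "is_bsset X" and Y: "is_bsset Y"
  shows "is_bsset (wedge X Y)"
proof -
  have SX: "is_sset X" and SY: "is_sset Y"
    using X Y by (auto simp: is_bsset_def)
  have *: "sact X m n \<theta> x \<in> simplices X m"
    if "\<theta> \<in> Delta m n" "x \<in> simplices X n" for m n \<theta> x
    using SX that unfolding is_sset_def by blast
  have **: "sact Y m n \<theta> y \<in> simplices Y m"
    if "\<theta> \<in> Delta m n" "y \<in> simplices Y n" for m n \<theta> y
    using SY that unfolding is_sset_def by blast
  have "is_sset (wedge X Y)"
    unfolding is_sset_def
  proof (intro conjI allI ballI)
    fix m n \<theta> z assume "\<theta> \<in> Delta m n" "z \<in> simplices (wedge X Y) n"
    then show "sact (wedge X Y) m n \<theta> z \<in> simplices (wedge X Y) m"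
      using * ** by (auto simp: simplices_wedge sact_wedge_inl sact_wedge_inr[OF X Y])
  next
    fix n z assume "z \<in> simplices (wedge X Y) n"
    then show "sact (wedge X Y) n n (\<lambda>i\<in>{..n}. i) z = z"
      using SX SY Delta_id[of n]
      by (auto simp: simplices_wedge sact_wedge_inl sact_wedge_inr[OF X Y] is_sset_def)
  next
    fix k m n \<phi> \<theta> z
    assume p: "\<phi> \<in> Delta k m" "\<theta> \<in> Delta m n" and z: "z \<in> simplices (wedge X Y) n"
    have fX: "sact X k n (compose {..k} \<theta> \<phi>) x = sact X k m \<phi> (sact X m n \<theta> x)"
      if "x \<in> simplices X n" for x
      using SX that p unfolding is_sset_def by blast
    have fY: "sact Y k n (compose {..k} \<theta> \<phi>) x = sact Y k m \<phi> (sact Y m n \<theta> x)"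
      if "x \<in> simplices Y n" for x
      using SY that p unfolding is_sset_def by blast
    show "sact (wedge X Y) k n (compose {..k} \<theta> \<phi>) z
        = sact (wedge X Y) k m \<phi> (sact (wedge X Y) m n \<theta> z)"
      using z p Delta_comp[OF p] * **
      by (auto simp: simplices_wedge sact_wedge_inl sact_wedge_inr[OF X Y] fX fY)
  qed
  then show ?thesis
    using X Y by (auto simp: is_bsset_def simplices_wedge) (auto simp: wedge_def)
qed

lemma wedge_pushout:
  fixes Z :: "('b, 'z) sset_scheme"
  assumes X: "is_bsset X" and Y: "is_bsset Y" and Z: "is_sset Z"
    and u: "u \<in> sset_hom X Z" and v: "v \<in> sset_hom Y Z"
    and uv: "u 0 (pt1 X) = v 0 (pt0 Y)"
  shows "(\<lambda>n. \<lambda>x\<in>simplices X n. InL x) \<in> sset_hom X (wedge X Y)"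
    and "(\<lambda>n. \<lambda>y\<in>simplices Y n. wedge_inr X Y n y) \<in> sset_hom Y (wedge X Y)"
    and "InL (pt1 X) = wedge_inr X Y 0 (pt0 Y)"
    and "\<exists>!w. w \<in> sset_hom (wedge X Y) Z \<and>
      (\<forall>n. \<forall>x \<in> simplices X n. w n (InL x) = u n x) \<and>
      (\<forall>n. \<forall>y \<in> simplices Y n. w n (wedge_inr X Y n y) = v n y)"
proof -
  have SX: "is_sset X" and SY: "is_sset Y" and
    pts: "pt0 Y \<in> simplices Y 0" "pt1 X \<in> simplices X 0"
    using X Y by (auto simp: is_bsset_def)
  have *: "sact X m n \<theta> x \<in> simplices X m"
    if "\<theta> \<in> Delta m n" "x \<in> simplices X n" for m n \<theta> x
    using SX that unfolding is_sset_def by blast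
  have **: "sact Y m n \<theta> y \<in> simplices Y m"
    if "\<theta> \<in> Delta m n" "y \<in> simplices Y n" for m n \<theta> y
    using SY that unfolding is_sset_def by blast
  show "(\<lambda>n. \<lambda>x\<in>simplices X n. InL x) \<in> sset_hom X (wedge X Y)"
    using * by (auto simp: sset_hom_def simplices_wedge sact_wedge_inl)
  show "(\<lambda>n. \<lambda>y\<in>simplices Y n. wedge_inr X Y n y) \<in> sset_hom Y (wedge X Y)"
    using ** by (auto simp: sset_hom_def simplices_wedge sact_wedge_inr[OF X Y])
  show "InL (pt1 X) = wedge_inr X Y 0 (pt0 Y)"
    using degen_0[OF SX pts(2)] degen_0[OF SY pts(1)] by (simp add: wedge_inr_def)
  define w where "w n = (\<lambda>z\<in>simplices (wedge X Y) n.
    case z of InL x \<Rightarrow> u n x | InR y \<Rightarrow> v n y | Base _ \<Rightarrow> undefined)" for n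
  have wl: "w n (InL x) = u n x" if "x \<in> simplices X n" for n x
    using that by (simp add: w_def simplices_wedge)
  have wr: "w n (wedge_inr X Y n y) = v n y" if "y \<in> simplices Y n" for n y
    using that hom_degen[OF u pts(2), of n] hom_degen[OF v pts(1), of n] uv
    by (auto simp: w_def simplices_wedge wedge_inr_def)
  have un: "u m (sact X m n \<theta> x) = sact Z m n \<theta> (u n x)" "u n x \<in> simplices Z n"
    if "\<theta> \<in> Delta m n" "x \<in> simplices X n" for m n \<theta> x
    using u that unfolding sset_hom_def by blast+
  have vn: "v m (sact Y m n \<theta> x) = sact Z m n \<theta> (v n x)" "v n x \<in> simplices Z n"
    if "\<theta> \<in> Delta m n" "x \<in> simplices Y n" for m n \<theta> x
    using v that unfolding sset_hom_def by blast+
  have "w n \<in> simplices (wedge X Y) n \<rightarrow>\<^sub>E simplices Z n" for n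
  proof (rule PiE_I)
    fix z assume "z \<in> simplices (wedge X Y) n"
    then show "w n z \<in> simplices Z n"
      using un(2)[OF Delta_id] vn(2)[OF Delta_id] by (auto simp: simplices_wedge wl wr)
  qed (simp add: w_def)
  moreover have "w m (sact (wedge X Y) m n \<theta> z) = sact Z m n \<theta> (w n z)"
    if "\<theta> \<in> Delta m n" "z \<in> simplices (wedge X Y) n" for m n \<theta> z
    using that * ** un vn by (auto simp: simplices_wedge sact_wedge_inl sact_wedge_inr[OF X Y] wl wr)
  ultimately have w: "w \<in> sset_hom (wedge X Y) Z"
    by (simp add: sset_hom_def)
  show "\<exists>!w. w \<in> sset_hom (wedge X Y) Z \<and>
      (\<forall>n. \<forall>x \<in> simplices X n. w n (InL x) = u n x) \<and>
      (\<forall>n. \<forall>y \<in> simplices Y n. w n (wedge_inr X Y n y) = v n y)"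
  proof (rule ex1I[of _ w])
    fix w' assume w': "w' \<in> sset_hom (wedge X Y) Z \<and>
      (\<forall>n. \<forall>x \<in> simplices X n. w' n (InL x) = u n x) \<and>
      (\<forall>n. \<forall>y \<in> simplices Y n. w' n (wedge_inr X Y n y) = v n y)"
    show "w' = w"
    proof
      fix n
      have "w' n \<in> simplices (wedge X Y) n \<rightarrow>\<^sub>E simplices Z n"
        "w n \<in> simplices (wedge X Y) n \<rightarrow>\<^sub>E simplices Z n"
        using w w' by (auto simp: sset_hom_def)
      then show "w' n = w n"
      proof (rule PiE_ext)
        fix z assume "z \<in> simplices (wedge X Y) n"
        then show "w' n z = w n z"
          using w' wl wr by (auto simp: simplices_wedge)
      qed
    qed
  qed (use w wl wr in auto)
qed


section \<open>Necklaces\<close>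

text \<open>A necklace is encoded by its list of bead dimensions \<open>n\<^sub>1, \<dots>, n\<^sub>k\<close>; \<open>necklace_sset\<close> is the
  bipointed simplicial set it stands for. The wedge is bracketed to the right and ends in the
  unit \<open>\<Delta>\<^sup>0\<close>. Using the lists as objects means that there is exactly one object for each
  \<open>\<Delta>\<^bsup>n\<^sub>1\<^esup> \<or> \<dots> \<or> \<Delta>\<^bsup>n\<^sub>k\<^esup>\<close>, as is needed for factorizations to be unique on the nose.\<close>

type_synonym necklace = "nat list"

definition necklaces :: "necklace set" where
  "necklaces = {ns. \<forall>n \<in> set ns. 0 < n}"

definition necklace_sset :: "necklace \<Rightarrow> simplex bsset" where
  "necklace_sset ns = foldr (\<lambda>n X. wedge (std_simplex n) X) ns (std_simplex 0)"

lemma is_bsset_necklace: "is_bsset (necklace_sset ns)"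
  by (induction ns) (auto simp: necklace_sset_def is_bsset_std_simplex is_bsset_wedge)

text \<open>Arrows are bipointed simplicial maps, tagged with domain and codomain.\<close>

type_synonym necklace_map = "necklace \<times> (nat \<Rightarrow> simplex \<Rightarrow> simplex) \<times> necklace"

definition Nec :: "(necklace, necklace_map) cat" where
  "Nec = \<lparr>
    Obj = necklaces,
    Arr = {(ns, f, ms). ns \<in> necklaces \<and> ms \<in> necklaces \<and>
            f \<in> bsset_hom (necklace_sset ns) (necklace_sset ms)},
    Dom = (\<lambda>(ns, f, ms). ns),
    Cod = (\<lambda>(ns, f, ms). ms),
    Id = (\<lambda>ns. (ns, \<lambda>i. \<lambda>x\<in>simplices (necklace_sset ns) i. x, ns)),
    Comp = (\<lambda>(ms', g, ls) (ns, f, ms).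
      (ns, \<lambda>i. compose (simplices (necklace_sset ns) i) (g i) (f i), ls))\<rparr>"

definition Nec_epis :: "necklace_map set" where
  "Nec_epis = {(ns, f, ms) \<in> Arr Nec. sset_epi (necklace_sset ns) (necklace_sset ms) f}"

definition Nec_monos :: "necklace_map set" where
  "Nec_monos = {(ns, f, ms) \<in> Arr Nec. sset_mono (necklace_sset ns) f}"

definition bead_length :: "necklace \<Rightarrow> nat" where
  "bead_length ns = length ns"

definition spine_length :: "necklace \<Rightarrow> nat" where
  "spine_length ns = sum_list ns"

text \<open>The truncated subtraction is exact because all beads have positive dimension.\<close>

definition nec_dim :: "necklace \<Rightarrow> nat" where
  "nec_dim ns = spine_length ns - bead_length ns"

text \<open>\<^typ>\<open>nat \<times> nat\<close> carries the lexicographic order.\<close>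

definition nec_deg :: "necklace \<Rightarrow> nat \<times> nat" where
  "nec_deg ns = (nec_dim ns, bead_length ns)"

end

theory Submission
  imports Defs "HOL-Library.Infinite_Set"
begin

text \<open>A necklace with spine length \<open>p\<close> is determined by its set \<open>T \<subseteq> [p]\<close> of joints, and its simplices
  are the monotone maps into \<open>[p]\<close> that do not jump over a joint. A bipointed map is therefore
  determined by its effect on vertices, and the possible vertex maps \<open>f : (T, p) \<rightarrow> (S, q)\<close> are the
  monotone, endpoint preserving ones with \<open>S \<subseteq> f(T)\<close>. Such a map is a monomorphism iff \<open>f\<close> is
  injective, and an epimorphism iff \<open>f\<close> is surjective and \<open>f(T) = S\<close>; hence the unique
  factorization goes through the image of \<open>f\<close> with joints \<open>f(T)\<close>. The dimension counts the
  vertices that are not joints. Non-joints of \<open>S\<close> only have non-joints as preimages under an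
  epimorphism, and monomorphisms send non-joints to non-joints, so the degree moves in the right
  direction; it stays the same only if \<open>f\<close> is a bijection with \<open>f(T) = S\<close>, that is, an identity.\<close>

section \<open>Joints\<close>

text \<open>The partial sums of the bead dimensions. Together with \<open>sum_list ns\<close> they
  form the pair (T, p) of the combinatorial description of necklaces.\<close>

primrec joints :: "necklace \<Rightarrow> nat set" where
  "joints [] = {0}"
| "joints (n # ns) = insert 0 ((+) n ` joints ns)"

lemma finite_joints [simp]: "finite (joints ns)"
  by (induction ns) auto

lemma zero_in_joints [simp]: "0 \<in> joints ns"
  by (cases ns) auto

lemma sum_list_in_joints [simp]: "sum_list ns \<in> joints ns"
  by (induction ns) auto

lemma joints_le: "t \<in> joints ns \<Longrightarrow> t \<le> sum_list ns"
  by (induction ns arbitrary: t) auto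

lemma Max_joints: "Max (joints ns) = sum_list ns"
  by (intro Max_eqI) (auto simp: joints_le)

lemma Cons_in_necklaces [simp]: "n # ns \<in> necklaces \<longleftrightarrow> 0 < n \<and> ns \<in> necklaces"
  by (auto simp: necklaces_def)

lemma Nil_in_necklaces [simp]: "[] \<in> necklaces"
  by (auto simp: necklaces_def)

lemma card_joints: "ns \<in> necklaces \<Longrightarrow> card (joints ns) = Suc (length ns)"
proof (induction ns)
  case (Cons n ns)
  then show ?case by (auto simp: card_insert_if card_image)
qed simp

text \<open>The list can be read off from its joints: the first bead is the least positive joint,
  and the joints from there on, shifted back, are those of the tail. This is what later turns equal
  joint sets into equal objects.\<close>

lemma joints_inject:
  "\<lbrakk>ns \<in> necklaces; ms \<in> necklaces; joints ns = joints ms\<rbrakk> \<Longrightarrow> ns = ms"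
proof (induction ns arbitrary: ms)
  case Nil
  then have "card (joints []) = Suc (length ms)"
    by (simp only: card_joints)
  then show ?case by simp
next
  case (Cons n ns)
  have "Suc (length ms) = Suc (length (n # ns))"
    using Cons.prems by (metis card_joints)
  then obtain m ms' where ms: "ms = m # ms'"
    by (cases ms) auto
  have pos: "0 < n" "0 < m" and tl: "ns \<in> necklaces" "ms' \<in> necklaces"
    using Cons.prems(1,2) by (simp_all add: ms)
  have least: "(LEAST t. t \<in> joints (k # ks) \<and> 0 < t) = k" if "0 < k" for k ks
    using that by (intro Least_equality) auto
  have "n = m"
    using least[OF pos(1)] least[OF pos(2)] Cons.prems(3) by (metis ms)
  have tail: "joints ks = {t. k + t \<in> joints (k # ks)}" if "0 < k" for k ks
    using that by auto
  have "joints ns = joints ms'"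
    using tail[OF pos(1)] tail[OF pos(2)] Cons.prems(3) by (metis ms \<open>n = m\<close>)
  then show ?case
    using Cons.IH[OF tl] \<open>n = m\<close> by (simp add: ms)
qed

text \<open>Cut off the first bead at the least positive element \<open>n\<close> and shift the rest
  of the set down by \<open>n\<close>; dropping 0 makes the set smaller, so induction on its size
  applies. It supplies the middle object of a factorization from the mere set of its joints.\<close>

lemma ex_joints:
  assumes "finite T" "0 \<in> T"
  shows "\<exists>ns \<in> necklaces. joints ns = T"
  using assms
proof (induction "card T" arbitrary: T rule: less_induct)
  case less
  show ?case
  proof (cases "T = {0}")
    case True
    then show ?thesis by (intro bexI[of _ "[]"]) auto
  next
    case False
    define n where "n = Min (T - {0})"
    have ne: "T - {0} \<noteq> {}" using False less.prems by auto
    have n: "n \<in> T" "0 < n"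
      using Min_in[of "T - {0}"] ne less.prems unfolding n_def[symmetric] by auto
    have le: "n \<le> t" if "t \<in> T" "t \<noteq> 0" for t
      using that less.prems by (auto simp: n_def)
    define U where "U = (\<lambda>t. t - n) ` (T - {0})"
    have "card U \<le> card (T - {0})"
      unfolding U_def by (rule card_image_le) (use less.prems in auto)
    also have "\<dots> < card T"
      using less.prems by (intro psubset_card_mono) auto
    finally have "card U < card T" .
    moreover have "finite U" using less.prems by (simp add: U_def)
    moreover have "0 \<in> U" unfolding U_def by (rule image_eqI[of _ _ n]) (use n in auto)
    ultimately obtain ns where ns: "ns \<in> necklaces" "joints ns = U"
      using less.hyps by blast
    have "(+) n ` U = T - {0}"
      using le by (simp add: U_def image_image)
    then have "joints (n # ns) = T"
      using ns(2) less.prems(2) by (simp add: insert_absorb)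
    then show ?thesis
      using ns(1) n(2) by (intro bexI[of _ "n # ns"]) simp_all
  qed
qed

lemma length_le_sum_list: "ns \<in> necklaces \<Longrightarrow> length ns \<le> sum_list ns"
  by (induction ns) auto

text \<open>A spine with p + 1 vertices carries k + 1 joints, and the two extra ones cancel. In this
  form dimensions can be compared by following vertices along a map.\<close>

lemma nec_dim_eq_card:
  assumes "ns \<in> necklaces"
  shows "nec_dim ns = card ({..sum_list ns} - joints ns)"
proof -
  have "joints ns \<subseteq> {..sum_list ns}" by (auto simp: joints_le)
  then show ?thesis
    using card_joints[OF assms]
    by (simp add: card_Diff_subset nec_dim_def spine_length_def bead_length_def)
qed

section \<open>Simplices of a necklace\<close>

text \<open>The \<open>m\<close>-simplices of a necklace are the monotone maps from \<open>[m]\<close> into its spine whose image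
  lies in a single bead.\<close>

definition bead_simplices :: "necklace \<Rightarrow> nat \<Rightarrow> (nat \<Rightarrow> nat) set" where
  "bead_simplices ns m =
    {\<sigma> \<in> Delta m (sum_list ns). \<forall>t \<in> joints ns. t \<le> \<sigma> 0 \<or> \<sigma> m \<le> t}"

text \<open>Forgets the nesting of wedges and keeps the sequence of vertices, numbered along the
  whole spine; hence the shift by \<open>n\<close> in the right summand. The \<open>Base\<close>
  branch is never reached on simplices of a wedge.\<close>

primrec decode :: "necklace \<Rightarrow> nat \<Rightarrow> simplex \<Rightarrow> nat \<Rightarrow> nat" where
  "decode [] m x = the_Base x"
| "decode (n # ns) m x = (case x of
      InL y \<Rightarrow> the_Base y
    | InR y \<Rightarrow> (\<lambda>i\<in>{..m}. n + decode ns m y i)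
    | Base _ \<Rightarrow> undefined)"

lemma necklace_sset_Nil: "necklace_sset [] = std_simplex 0"
  by (simp add: necklace_sset_def)

lemma necklace_sset_Cons:
  "necklace_sset (n # ns) = wedge (std_simplex n) (necklace_sset ns)"
  by (simp add: necklace_sset_def)

lemma degen_pt1_std_simplex:
  "degen (std_simplex n) m (pt1 (std_simplex n)) = Base (\<lambda>i\<in>{..m}. n)"
  by (auto simp: degen_def std_simplex_def compose_def fun_eq_iff)

lemma decode_degen_pt0:
  "decode ns m (degen (necklace_sset ns) m (pt0 (necklace_sset ns))) = (\<lambda>i\<in>{..m}. 0)"
  by (cases ns)
    (auto simp: necklace_sset_Nil necklace_sset_Cons degen_def std_simplex_def wedge_def
      compose_def fun_eq_iff)

text \<open>Both branches of \<open>wedge_inr\<close> give the same formula, because the glued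
  simplex is constantly 0 in the tail and constantly \<open>n\<close> in the first bead.\<close>

lemma decode_wedge_inr:
  "decode (n # ns) m (wedge_inr (std_simplex n) (necklace_sset ns) m y)
    = (\<lambda>i\<in>{..m}. n + decode ns m y i)"
  by (auto simp: wedge_inr_def decode_degen_pt0 degen_pt1_std_simplex fun_eq_iff)

lemma decode_pt0: "decode ns 0 (pt0 (necklace_sset ns)) = (\<lambda>i\<in>{..0}. 0)"
  by (cases ns) (auto simp: necklace_sset_Nil necklace_sset_Cons std_simplex_def wedge_def)

lemma decode_pt1: "decode ns 0 (pt1 (necklace_sset ns)) = (\<lambda>i\<in>{..0}. sum_list ns)"
proof (induction ns)
  case (Cons n ns)
  have "pt1 (necklace_sset (n # ns))
      = wedge_inr (std_simplex n) (necklace_sset ns) 0 (pt1 (necklace_sset ns))"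
    by (simp add: necklace_sset_Cons wedge_def)
  then show ?case
    using Cons by (simp only: decode_wedge_inr) (auto simp: fun_eq_iff)
qed (simp add: necklace_sset_Nil std_simplex_def)

lemma simplices_necklace_Cons:
  "simplices (necklace_sset (n # ns)) m = InL ` Base ` Delta m n \<union>
    wedge_inr (std_simplex n) (necklace_sset ns) m ` simplices (necklace_sset ns) m"
  by (simp add: necklace_sset_Cons simplices_wedge std_simplex_def)

lemma Delta_le: "\<theta> \<in> Delta m n \<Longrightarrow> i \<le> m \<Longrightarrow> \<theta> i \<le> n"
  by (auto simp: Delta_def)

lemma Delta_mono: "\<theta> \<in> Delta m n \<Longrightarrow> i \<le> j \<Longrightarrow> j \<le> m \<Longrightarrow> \<theta> i \<le> \<theta> j"
  by (auto simp: Delta_def mono_on_def)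

lemma Delta_codomain:
  "\<lbrakk>\<theta> \<in> Delta m n; \<And>i. i \<le> m \<Longrightarrow> \<theta> i \<le> n'\<rbrakk> \<Longrightarrow> \<theta> \<in> Delta m n'"
  by (auto simp: Delta_def PiE_def Pi_def)

lemma Delta_eqI:
  "\<lbrakk>\<theta> \<in> Delta m n; \<theta>' \<in> Delta m n'; \<And>i. i \<le> m \<Longrightarrow> \<theta> i = \<theta>' i\<rbrakk> \<Longrightarrow> \<theta> = \<theta>'"
  unfolding Delta_def by (auto intro: extensionalityI[of _ "{..m}"] simp: PiE_def)

lemma DeltaI:
  "\<lbrakk>\<And>i. i \<le> m \<Longrightarrow> \<theta> i \<le> n; \<And>i j. i \<le> j \<Longrightarrow> j \<le> m \<Longrightarrow> \<theta> i \<le> \<theta> j\<rbrakk>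
    \<Longrightarrow> (\<lambda>i\<in>{..m}. \<theta> i) \<in> Delta m n"
  by (auto simp: Delta_def mono_on_def)

text \<open>In a single bead the action is precomposition by definition, and shifting the values by
  \<open>k\<close> commutes with precomposition.\<close>

lemma decode_sact:
  "\<lbrakk>\<theta> \<in> Delta m n; x \<in> simplices (necklace_sset ns) n\<rbrakk> \<Longrightarrow>
    decode ns m (sact (necklace_sset ns) m n \<theta> x) = compose {..m} (decode ns n x) \<theta>"
proof (induction ns arbitrary: x)
  case Nil
  then show ?case by (auto simp: necklace_sset_Nil std_simplex_def)
next
  case (Cons k ns)
  note b = is_bsset_std_simplex[of k] is_bsset_necklace[of ns]
  from Cons.prems(2) consider (L) \<sigma> where "x = InL (Base \<sigma>)"
    | (R) y where "y \<in> simplices (necklace_sset ns) n"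
        "x = wedge_inr (std_simplex k) (necklace_sset ns) n y"
    by (auto simp: simplices_necklace_Cons)
  then show ?case
  proof cases
    case L
    then show ?thesis by (simp add: necklace_sset_Cons sact_wedge_inl) (simp add: std_simplex_def)
  next
    case R
    show ?thesis
      unfolding R(2) necklace_sset_Cons sact_wedge_inr[OF b Cons.prems(1) R(1)] decode_wedge_inr
      using Cons.IH[OF Cons.prems(1) R(1)] Delta_le[OF Cons.prems(1)]
      by (auto simp: compose_def fun_eq_iff)
  qed
qed

lemma shift_bead_simplices:
  assumes "\<tau> \<in> bead_simplices ns m"
  shows "(\<lambda>i\<in>{..m}. n + \<tau> i) \<in> bead_simplices (n # ns) m"
  using assms by (auto simp: bead_simplices_def intro!: DeltaI dest: Delta_le Delta_mono)

text \<open>The joint \<open>n\<close> separates the first bead from the tail: a simplex that does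
  not jump over it either ends at or before \<open>n\<close> or starts at or after \<open>n\<close>.
  Both happen only for the constant simplex at \<open>n\<close>, which is exactly what the wedge
  identifies.\<close>

lemma bij_betw_decode:
  "bij_betw (decode ns m) (simplices (necklace_sset ns) m) (bead_simplices ns m)"
proof (induction ns)
  case Nil
  have "bead_simplices [] m = Delta m 0"
    by (auto simp: bead_simplices_def Delta_0)
  then show ?case
    by (auto simp: bij_betw_def inj_on_def necklace_sset_Nil std_simplex_def image_image)
next
  case (Cons n ns)
  let ?X = "necklace_sset ns"
  let ?r = "wedge_inr (std_simplex n) ?X m"
  have mem: "decode ns m y \<in> bead_simplices ns m" if "y \<in> simplices ?X m" for y
    using Cons that by (auto simp: bij_betw_def)
  have deg: "degen ?X m (pt0 ?X) \<in> simplices ?X m"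
    using is_bsset_necklace[of ns] Delta_const[of m 0]
    by (auto simp: degen_def is_bsset_def is_sset_def)
  have img: "decode (n # ns) m ` simplices (necklace_sset (n # ns)) m = bead_simplices (n # ns) m"
  proof (intro equalityI subsetI)
    fix \<sigma> assume "\<sigma> \<in> decode (n # ns) m ` simplices (necklace_sset (n # ns)) m"
    then obtain x where x: "x \<in> simplices (necklace_sset (n # ns)) m"
      "\<sigma> = decode (n # ns) m x" by blast
    from x(1) consider (L) \<tau> where "\<tau> \<in> Delta m n" "x = InL (Base \<tau>)"
      | (R) y where "y \<in> simplices ?X m" "x = ?r y"
      unfolding simplices_necklace_Cons by blast
    then show "\<sigma> \<in> bead_simplices (n # ns) m"
    proof cases
      case L
      then have \<sigma>: "\<sigma> \<in> Delta m n" by (simp add: x(2))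
      have le: "\<sigma> i \<le> n" if "i \<le> m" for i using Delta_le[OF \<sigma> that] .
      have "\<sigma> \<in> Delta m (n + sum_list ns)"
        by (rule Delta_codomain[OF \<sigma>]) (simp add: le trans_le_add1)
      moreover have "t \<le> \<sigma> 0 \<or> \<sigma> m \<le> t" if "t \<in> joints (n # ns)" for t
        using that le[of m] by auto
      ultimately show ?thesis
        by (simp add: bead_simplices_def)
    next
      case R
      then show ?thesis
        using shift_bead_simplices[OF mem] by (simp only: x(2) decode_wedge_inr)
    qed
  next
    fix \<sigma> assume \<sigma>: "\<sigma> \<in> bead_simplices (n # ns) m"
    then have D: "\<sigma> \<in> Delta m (n + sum_list ns)" by (simp add: bead_simplices_def)
    \<comment> \<open>The joint condition at \<open>n\<close> itself decides which summand of the
      wedge contains the preimage.\<close>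
    have "n \<in> joints (n # ns)" by (auto simp: image_iff)
    then consider "\<sigma> m \<le> n" | "n \<le> \<sigma> 0"
      using \<sigma> by (auto simp only: bead_simplices_def)
    then show "\<sigma> \<in> decode (n # ns) m ` simplices (necklace_sset (n # ns)) m"
    proof cases
      case 1
      have "\<sigma> \<in> Delta m n"
      proof (rule Delta_codomain[OF D])
        fix i assume "i \<le> m"
        then show "\<sigma> i \<le> n" using 1 Delta_mono[OF D, of i m] by simp
      qed
      then have "InL (Base \<sigma>) \<in> simplices (necklace_sset (n # ns)) m"
        by (auto simp: simplices_necklace_Cons)
      then show ?thesis by (rule image_eqI[rotated]) simp
    next
      case 2
      define \<tau> where "\<tau> = (\<lambda>i\<in>{..m}. \<sigma> i - n)"
      have ge: "n \<le> \<sigma> i" if "i \<le> m" for i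
        using 2 Delta_mono[OF D, of 0 i] that by simp
      have "\<tau> \<in> Delta m (sum_list ns)"
        unfolding \<tau>_def
      proof (rule DeltaI)
        fix i assume "i \<le> m"
        then show "\<sigma> i - n \<le> sum_list ns" using Delta_le[OF D, of i] by simp
      next
        fix i j assume "i \<le> j" "j \<le> m"
        then show "\<sigma> i - n \<le> \<sigma> j - n" using Delta_mono[OF D, of i j] by simp
      qed
      moreover have "t \<le> \<tau> 0 \<or> \<tau> m \<le> t" if "t \<in> joints ns" for t
      proof -
        have "n + t \<in> joints (n # ns)" using that by auto
        then have "n + t \<le> \<sigma> 0 \<or> \<sigma> m \<le> n + t"
          using \<sigma> by (auto simp only: bead_simplices_def)
        then show ?thesis by (auto simp: \<tau>_def)
      qed
      ultimately have "\<tau> \<in> bead_simplices ns m" by (simp add: bead_simplices_def)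
      then obtain y where y: "y \<in> simplices ?X m" "\<tau> = decode ns m y"
        using bij_betw_imp_surj_on[OF Cons] by blast
      have "\<sigma> i = n + \<tau> i" if "i \<le> m" for i
        using that ge by (simp add: \<tau>_def)
      then have "\<sigma> = (\<lambda>i\<in>{..m}. n + \<tau> i)"
        using D by (auto simp: fun_eq_iff Delta_def PiE_def extensional_def)
      then have "\<sigma> = decode (n # ns) m (?r y)"
        using y by (simp only: decode_wedge_inr)
      then show ?thesis
        using y by (auto simp: simplices_necklace_Cons simp del: decode.simps)
    qed
  qed
  have inj_r: "y = y'" if y: "y \<in> simplices ?X m" "y' \<in> simplices ?X m"
    and eq: "(\<lambda>i\<in>{..m}. n + decode ns m y i) = (\<lambda>i\<in>{..m}. n + decode ns m y' i)" for y y'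
  proof -
    have "decode ns m y i = decode ns m y' i" if "i \<le> m" for i
      using fun_cong[OF eq, of i] that by simp
    then have "decode ns m y = decode ns m y'"
      using mem[OF y(1)] mem[OF y(2)] unfolding bead_simplices_def
      by (intro Delta_eqI[of _ m "sum_list ns" _ "sum_list ns"]) auto
    with bij_betw_imp_inj_on[OF Cons] show ?thesis using y by (rule inj_onD)
  qed
  \<comment> \<open>The only overlap of the two summands: values at most \<open>n\<close> on one
    side and at least \<open>n\<close> on the other leave the degenerate simplex on the gluing
    vertex.\<close>
  have inj_lr: "InL (Base \<sigma>) = ?r y" if y: "y \<in> simplices ?X m" and \<sigma>: "\<sigma> \<in> Delta m n"
    and eq: "\<sigma> = (\<lambda>i\<in>{..m}. n + decode ns m y i)" for y \<sigma>
  proof -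
    have zero: "decode ns m y i = 0" if "i \<le> m" for i
      using Delta_le[OF \<sigma> that] that by (simp add: eq)
    then have "y = degen ?X m (pt0 ?X)"
      by (intro inj_r[OF y deg]) (simp add: decode_degen_pt0 cong: restrict_cong)
    moreover have "\<sigma> = (\<lambda>i\<in>{..m}. n)"
      using zero by (auto simp: eq)
    ultimately show ?thesis
      by (auto simp: wedge_inr_def degen_pt1_std_simplex)
  qed
  have "inj_on (decode (n # ns) m) (simplices (necklace_sset (n # ns)) m)"
    unfolding simplices_necklace_Cons
  proof (rule inj_onI)
    fix x x'
    assume x: "x \<in> InL ` Base ` Delta m n \<union> ?r ` simplices ?X m"
      and x': "x' \<in> InL ` Base ` Delta m n \<union> ?r ` simplices ?X m"
      and eq: "decode (n # ns) m x = decode (n # ns) m x'"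
    have decode_inl: "decode (n # ns) m (InL (Base \<sigma>)) = \<sigma>" for \<sigma> by simp
    from x consider (L) \<sigma> where "\<sigma> \<in> Delta m n" "x = InL (Base \<sigma>)"
      | (R) y where "y \<in> simplices ?X m" "x = ?r y"
      by blast
    note x_cases = this
    from x' consider (L') \<sigma> where "\<sigma> \<in> Delta m n" "x' = InL (Base \<sigma>)"
      | (R') y where "y \<in> simplices ?X m" "x' = ?r y"
      by blast
    note x'_cases = this
    show "x = x'"
    proof (cases rule: x_cases)
      case (L \<sigma>)
      show ?thesis
      proof (cases rule: x'_cases)
        case L'
        then show ?thesis using eq unfolding L(2) L'(2) decode_inl by simp
      next
        case R'
        show ?thesis
          using inj_lr[OF R'(1) L(1)] eq unfolding L(2) R'(2) decode_inl decode_wedge_inr .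
      qed
    next
      case (R y)
      show ?thesis
      proof (cases rule: x'_cases)
        case L'
        show ?thesis
          using inj_lr[OF R(1) L'(1)] eq unfolding L'(2) R(2) decode_inl decode_wedge_inr by metis
      next
        case R'
        show ?thesis
          using inj_r[OF R(1) R'(1)] eq unfolding R(2) R'(2) decode_wedge_inr by simp
      qed
    qed
  qed
  then show ?case using img by (rule bij_betw_imageI)
qed

lemma decode_in: "x \<in> simplices (necklace_sset ns) m \<Longrightarrow> decode ns m x \<in> bead_simplices ns m"
  using bij_betw_decode by (rule bij_betw_apply)

lemma decode_inject:
  "\<lbrakk>x \<in> simplices (necklace_sset ns) m; y \<in> simplices (necklace_sset ns) m;
    decode ns m x = decode ns m y\<rbrakk> \<Longrightarrow> x = y"
  using bij_betw_imp_inj_on[OF bij_betw_decode] by (rule inj_onD)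

lemma decode_surj:
  assumes "\<sigma> \<in> bead_simplices ns m"
  obtains x where "x \<in> simplices (necklace_sset ns) m" "decode ns m x = \<sigma>"
proof -
  have "\<sigma> \<in> decode ns m ` simplices (necklace_sset ns) m"
    unfolding bij_betw_imp_surj_on[OF bij_betw_decode] by (rule assms)
  then show ?thesis using that by (elim imageE) simp
qed

lemma bead_simplicesD: "\<sigma> \<in> bead_simplices ns m \<Longrightarrow> \<sigma> \<in> Delta m (sum_list ns)"
  by (simp add: bead_simplices_def)

lemma vertex_in_bead_simplices: "v \<le> sum_list ns \<Longrightarrow> (\<lambda>i\<in>{..0}. v) \<in> bead_simplices ns 0"
  by (auto simp: bead_simplices_def Delta_def mono_on_def)

text \<open>Edges are the test simplices below: they detect both monotonicity and jumps over joints,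
  which vertices alone cannot see.\<close>

lemma edge_in_bead_simplices:
  assumes "u \<le> v" "v \<le> sum_list ns" "\<And>t. t \<in> joints ns \<Longrightarrow> t \<le> u \<or> v \<le> t"
  shows "(\<lambda>i\<in>{..1}. if i = 0 then u else v) \<in> bead_simplices ns 1"
  using assms unfolding bead_simplices_def by (auto intro!: DeltaI)

section \<open>Necklace maps as vertex maps\<close>

definition vertex_maps :: "necklace \<Rightarrow> necklace \<Rightarrow> (nat \<Rightarrow> nat) set" where
  "vertex_maps ns ms = {f \<in> Delta (sum_list ns) (sum_list ms).
    f 0 = 0 \<and> f (sum_list ns) = sum_list ms \<and> joints ms \<subseteq> f ` joints ns}"

text \<open>By \<open>bij_betw_decode\<close> the inverse image is a single simplex whenever the
  composite is a simplex of \<open>ms\<close>. The restriction makes the map extensional, so that it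
  can be equal, and not just agree on simplices, with an element of
  \<open>bsset_hom\<close>.\<close>

definition realize ::
  "necklace \<Rightarrow> necklace \<Rightarrow> (nat \<Rightarrow> nat) \<Rightarrow> nat \<Rightarrow> simplex \<Rightarrow> simplex" where
  "realize ns ms f = (\<lambda>i. \<lambda>x\<in>simplices (necklace_sset ns) i.
    inv_into (simplices (necklace_sset ms) i) (decode ms i) (compose {..i} f (decode ns i x)))"

text \<open>A joint \<open>s\<close> of \<open>ms\<close> is the image of a joint \<open>t\<close>
  of \<open>ns\<close>. Since \<sigma> does not jump over \<open>t\<close> and \<open>f\<close> is
  monotone, the composite does not jump over \<open>s\<close>.\<close>

lemma compose_vertex_map:
  assumes f: "f \<in> vertex_maps ns ms" and \<sigma>: "\<sigma> \<in> bead_simplices ns m"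
  shows "compose {..m} f \<sigma> \<in> bead_simplices ms m"
proof -
  have D: "f \<in> Delta (sum_list ns) (sum_list ms)" "\<sigma> \<in> Delta m (sum_list ns)"
    using f \<sigma> by (auto simp: vertex_maps_def bead_simplices_def)
  have "s \<le> f (\<sigma> 0) \<or> f (\<sigma> m) \<le> s" if s: "s \<in> joints ms" for s
  proof -
    have "s \<in> f ` joints ns"
      using f s by (auto simp: vertex_maps_def)
    then obtain t where t: "s = f t" "t \<in> joints ns"
      by (rule imageE)
    then have "t \<le> \<sigma> 0 \<or> \<sigma> m \<le> t" using \<sigma> by (simp add: bead_simplices_def)
    moreover have "\<sigma> 0 \<le> sum_list ns" "t \<le> sum_list ns"
      using Delta_le[OF D(2)] joints_le[OF t(2)] by simp_all
    ultimately show ?thesis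
      using Delta_mono[OF D(1), of t "\<sigma> 0"] Delta_mono[OF D(1), of "\<sigma> m" t] by (auto simp: t(1))
  qed
  then show ?thesis
    using Delta_comp[OF D(2,1)] by (simp add: bead_simplices_def compose_def)
qed

lemma realize_in:
  assumes "f \<in> vertex_maps ns ms" "x \<in> simplices (necklace_sset ns) m"
  shows "realize ns ms f m x \<in> simplices (necklace_sset ms) m"
    and "decode ms m (realize ns ms f m x) = compose {..m} f (decode ns m x)"
proof -
  have "compose {..m} f (decode ns m x) \<in> decode ms m ` simplices (necklace_sset ms) m"
    using compose_vertex_map[OF assms(1) decode_in[OF assms(2)]] bij_betw_decode[of ms m]
    by (simp add: bij_betw_def)
  then show "realize ns ms f m x \<in> simplices (necklace_sset ms) m"
    and "decode ms m (realize ns ms f m x) = compose {..m} f (decode ns m x)"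
    using assms(2) by (simp_all add: realize_def inv_into_into f_inv_into_f)
qed

lemma sact_in:
  "\<lbrakk>\<theta> \<in> Delta m n; x \<in> simplices (necklace_sset ns) n\<rbrakk> \<Longrightarrow>
    sact (necklace_sset ns) m n \<theta> x \<in> simplices (necklace_sset ns) m"
  using is_bsset_necklace[of ns] by (simp add: is_bsset_def is_sset_def)

lemma pts_in:
  "pt0 (necklace_sset ns) \<in> simplices (necklace_sset ns) 0"
  "pt1 (necklace_sset ns) \<in> simplices (necklace_sset ns) 0"
  using is_bsset_necklace[of ns] by (simp_all add: is_bsset_def)

lemma realize_in_bsset_hom:
  assumes f: "f \<in> vertex_maps ns ms"
  shows "realize ns ms f \<in> bsset_hom (necklace_sset ns) (necklace_sset ms)"
proof -
  have "realize ns ms f m (sact (necklace_sset ns) m n \<theta> x)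
      = sact (necklace_sset ms) m n \<theta> (realize ns ms f n x)"
    if "\<theta> \<in> Delta m n" "x \<in> simplices (necklace_sset ns) n" for m n \<theta> x
    using that realize_in[OF f that(2)] realize_in[OF f sact_in[OF that]] Delta_le[OF that(1)]
    by (intro decode_inject[of _ ms m])
      (auto simp: sact_in decode_sact compose_def fun_eq_iff)
  moreover have "realize ns ms f m \<in> simplices (necklace_sset ns) m \<rightarrow>\<^sub>E simplices (necklace_sset ms) m"
    for m
    using realize_in(1)[OF f] by (auto simp: realize_def)
  moreover have "realize ns ms f 0 (pt0 (necklace_sset ns)) = pt0 (necklace_sset ms)"
    "realize ns ms f 0 (pt1 (necklace_sset ns)) = pt1 (necklace_sset ms)"
    using f by (auto intro!: decode_inject[of _ ms 0] simp: realize_in[OF f] pts_in decode_pt0 decode_pt1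
        compose_def fun_eq_iff vertex_maps_def)
  ultimately show ?thesis
    by (simp add: bsset_hom_def sset_hom_def)
qed

text \<open>Simplices of a necklace are determined by their vertices, so naturality determines
  \<open>F\<close> from its values on 0-simplices. The properties of the resulting vertex map come
  from the images of edges, and the endpoint conditions from the base points.\<close>

lemma bsset_hom_eq_realize:
  assumes F: "F \<in> bsset_hom (necklace_sset ns) (necklace_sset ms)"
  shows "\<exists>f \<in> vertex_maps ns ms. F = realize ns ms f"
proof -
  let ?X = "necklace_sset ns" and ?Y = "necklace_sset ms"
  let ?p = "sum_list ns" and ?q = "sum_list ms"
  have F_in: "F n x \<in> simplices ?Y n" if "x \<in> simplices ?X n" for n x
    using F that by (auto simp: bsset_hom_def sset_hom_def)
  have F_sact: "F m (sact ?X m n \<theta> x) = sact ?Y m n \<theta> (F n x)"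
    if "\<theta> \<in> Delta m n" "x \<in> simplices ?X n" for m n \<theta> x
    using F that by (auto simp: bsset_hom_def sset_hom_def)
  have F_pts: "F 0 (pt0 ?X) = pt0 ?Y" "F 0 (pt1 ?X) = pt1 ?Y"
    using F by (auto simp: bsset_hom_def)
  \<comment> \<open>\<open>e v\<close> is the 0-simplex sitting at the spine vertex
    \<open>v\<close>; \<open>f\<close> below reads off where \<open>F\<close> sends it.\<close>
  define e where "e v = inv_into (simplices ?X 0) (decode ns 0) (\<lambda>i\<in>{..0}. v)" for v
  have e: "e v \<in> simplices ?X 0" "decode ns 0 (e v) = (\<lambda>i\<in>{..0}. v)" if "v \<le> ?p" for v
    using vertex_in_bead_simplices[OF that] bij_betw_decode[of ns 0]
    by (auto simp: e_def bij_betw_def inv_into_into f_inv_into_f)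
  define f where "f = (\<lambda>v\<in>{..?p}. decode ms 0 (F 0 (e v)) 0)"
  \<comment> \<open>Naturality along the map from [0] to [n] that picks out
    \<open>i\<close>.\<close>
  have key: "decode ms n (F n x) i = f (decode ns n x i)"
    if x: "x \<in> simplices ?X n" and i: "i \<le> n" for n x i
  proof -
    have c: "(\<lambda>j\<in>{..0}. i) \<in> Delta 0 n" using i by (auto simp: Delta_def mono_on_def)
    have le: "decode ns n x i \<le> ?p"
      using Delta_le[OF bead_simplicesD[OF decode_in[OF x]] i] .
    have "sact ?X 0 n (\<lambda>j\<in>{..0}. i) x = e (decode ns n x i)"
      using e[OF le] by (intro decode_inject[of _ ns 0])
        (auto simp: decode_sact[OF c x] sact_in[OF c x] compose_def fun_eq_iff simp del: atMost_0)
    then have "F 0 (e (decode ns n x i)) = sact ?Y 0 n (\<lambda>j\<in>{..0}. i) (F n x)"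
      using F_sact[OF c x] by simp
    then show ?thesis
      using le by (simp add: f_def decode_sact[OF c F_in[OF x]] compose_def del: atMost_0)
  qed
  have F_decode: "decode ms n (F n x) = compose {..n} f (decode ns n x)"
    if x: "x \<in> simplices ?X n" for n x
    using bead_simplicesD[OF decode_in[OF F_in[OF x]]] key[OF x]
    by (auto simp: fun_eq_iff compose_def Delta_def PiE_def extensional_def)
  \<comment> \<open>Two vertices with no joint strictly between them span a 1-simplex. Its image is
    a 1-simplex of \<open>ms\<close>, hence increasing and not jumping over a joint.\<close>
  have edge: "f u \<le> f v" "\<And>s. s \<in> joints ms \<Longrightarrow> s \<le> f u \<or> f v \<le> s"
    if uv: "u \<le> v" "v \<le> ?p" "\<And>t. t \<in> joints ns \<Longrightarrow> t \<le> u \<or> v \<le> t" for u v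
  proof -
    obtain x where x: "x \<in> simplices ?X 1"
      "decode ns 1 x = (\<lambda>i\<in>{..1}. if i = 0 then u else v)"
      using decode_surj[OF edge_in_bead_simplices[OF uv]] .
    have b: "decode ms 1 (F 1 x) \<in> bead_simplices ms 1"
      "decode ms 1 (F 1 x) 0 = f u" "decode ms 1 (F 1 x) 1 = f v"
      using decode_in[OF F_in[OF x(1)]] key[OF x(1)] x(2) by auto
    then show "f u \<le> f v" "\<And>s. s \<in> joints ms \<Longrightarrow> s \<le> f u \<or> f v \<le> s"
      using Delta_mono[OF bead_simplicesD[OF b(1)], of 0 1] by (auto simp: bead_simplices_def)
  qed
  \<comment> \<open>Nothing lies strictly between consecutive vertices, so they always span an edge;
    distant ones are reached step by step.\<close>
  have mono: "f u \<le> f v" if "u \<le> v" "v \<le> ?p" for u v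
    using that
  proof (induction v rule: dec_induct)
    case (step v)
    have "f v \<le> f (Suc v)" using step.prems by (intro edge) auto
    then show ?case using step by simp
  qed simp
  have f_le: "f v \<le> ?q" if "v \<le> ?p" for v
    using Delta_le[OF bead_simplicesD[OF decode_in[OF F_in[OF e(1)[OF that]]]], of 0] that
    by (simp add: f_def)
  have "f 0 = 0" "f ?p = ?q"
    using key[OF pts_in(1), of 0] key[OF pts_in(2), of 0]
    by (simp_all add: F_pts decode_pt0 decode_pt1)
  moreover have "f \<in> Delta ?p ?q"
    using mono f_le by (auto simp: Delta_def mono_on_def f_def)
  moreover have "s \<in> f ` joints ns" if s: "s \<in> joints ms" for s
  proof (rule ccontr)
    assume not: "s \<notin> f ` joints ns"
    \<comment> \<open>If no joint maps to \<open>s\<close>, each joint maps below or above it. The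
      last joint mapping below and the first mapping above then have no joint between them, so they
      span an edge whose image jumps over \<open>s\<close>.\<close>
    define A where "A = {t \<in> joints ns. f t < s}"
    define B where "B = {t \<in> joints ns. s < f t}"
    have "s \<noteq> 0" "s \<noteq> ?q"
      using not \<open>f 0 = 0\<close> \<open>f ?p = ?q\<close> by (metis image_eqI zero_in_joints sum_list_in_joints)+
    then have "0 \<in> A" "?p \<in> B"
      using joints_le[OF s] by (auto simp: A_def B_def \<open>f 0 = 0\<close> \<open>f ?p = ?q\<close>)
    moreover have "finite A" "finite B" by (auto simp: A_def B_def)
    ultimately have AB: "Max A \<in> A" "Min B \<in> B" "\<And>t. t \<in> A \<Longrightarrow> t \<le> Max A" "\<And>t. t \<in> B \<Longrightarrow> Min B \<le> t"
      by (metis Max_in empty_iff, metis Min_in empty_iff, simp_all)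
    have "Max A \<in> joints ns" "Min B \<in> joints ns" "f (Max A) < s" "s < f (Min B)"
      using AB(1,2) by (auto simp: A_def B_def)
    moreover have "Max A \<le> Min B"
      using mono[of "Min B" "Max A"] calculation joints_le[of "Max A" ns] by force
    moreover have "t \<le> Max A \<or> Min B \<le> t" if "t \<in> joints ns" for t
    proof -
      have "t \<in> A \<or> t \<in> B" using that not by (force simp: A_def B_def)
      then show ?thesis using AB by blast
    qed
    ultimately have "s \<le> f (Max A) \<or> f (Min B) \<le> s"
      using s joints_le by (intro edge(2)) auto
    then show False using \<open>f (Max A) < s\<close> \<open>s < f (Min B)\<close> by simp
  qed
  ultimately have f: "f \<in> vertex_maps ns ms" by (auto simp: vertex_maps_def)
  have "F n x = realize ns ms f n x" for n x
  proof (cases "x \<in> simplices ?X n")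
    case True
    then show ?thesis
      using F_in realize_in[OF f True] F_decode by (intro decode_inject[of _ ms n]) auto
  next
    case False
    moreover have "F n \<in> extensional (simplices ?X n)"
      using F by (auto simp: bsset_hom_def sset_hom_def PiE_def)
    ultimately show ?thesis by (simp add: realize_def extensional_def)
  qed
  then show ?thesis using f by blast
qed

section \<open>Faithfulness, composition and identities\<close>

lemma realize_inject:
  assumes f: "f \<in> vertex_maps ns ms" and g: "g \<in> vertex_maps ns ms"
    and eq: "realize ns ms f = realize ns ms g"
  shows "f = g"
proof (rule Delta_eqI)
  fix v assume "v \<le> sum_list ns"
  from decode_surj[OF vertex_in_bead_simplices[OF this]]
  obtain x where x: "x \<in> simplices (necklace_sset ns) 0" "decode ns 0 x = (\<lambda>i\<in>{..0}. v)" .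
  have "compose {..0} f (decode ns 0 x) = compose {..0} g (decode ns 0 x)"
    using realize_in(2)[OF f x(1)] realize_in(2)[OF g x(1)] eq by simp
  from fun_cong[OF this, of 0] show "f v = g v"
    by (simp add: compose_def x(2))
qed (use f g in \<open>auto simp: vertex_maps_def\<close>)

lemma realize_compose:
  assumes f: "f \<in> vertex_maps ns ms" and g: "g \<in> vertex_maps ms ls"
  shows "compose {..sum_list ns} g f \<in> vertex_maps ns ls"
    and "(\<lambda>i. compose (simplices (necklace_sset ns) i) (realize ms ls g i) (realize ns ms f i))
      = realize ns ls (compose {..sum_list ns} g f)"
proof -
  let ?gf = "compose {..sum_list ns} g f"
  have "?gf ` joints ns = g ` f ` joints ns"
    by (auto simp: compose_def image_iff joints_le)
  then have "joints ls \<subseteq> ?gf ` joints ns"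
    using f g unfolding vertex_maps_def by blast
  moreover have "?gf \<in> Delta (sum_list ns) (sum_list ls)"
    using f g by (auto simp: vertex_maps_def intro: Delta_comp)
  ultimately show gf: "?gf \<in> vertex_maps ns ls"
    using f g by (auto simp: vertex_maps_def compose_def)
  have "compose (simplices (necklace_sset ns) i) (realize ms ls g i) (realize ns ms f i) x
      = realize ns ls ?gf i x" for i x
  proof (cases "x \<in> simplices (necklace_sset ns) i")
    case True
    note x = realize_in[OF f True]
    have le: "decode ns i x j \<le> sum_list ns" if "j \<le> i" for j
      using Delta_le[OF bead_simplicesD[OF decode_in[OF True]] that] .
    show ?thesis
      using True x realize_in[OF g x(1)] realize_in[OF gf True] le
      by (intro decode_inject[of _ ls i]) (auto simp: compose_def fun_eq_iff)
  qed (simp add: compose_def realize_def)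
  then show "(\<lambda>i. compose (simplices (necklace_sset ns) i) (realize ms ls g i) (realize ns ms f i))
      = realize ns ls ?gf"
    by (simp add: fun_eq_iff)
qed

lemma realize_id:
  shows "(\<lambda>v\<in>{..sum_list ns}. v) \<in> vertex_maps ns ns"
    and "realize ns ns (\<lambda>v\<in>{..sum_list ns}. v) = (\<lambda>i. \<lambda>x\<in>simplices (necklace_sset ns) i. x)"
proof -
  let ?i = "\<lambda>v\<in>{..sum_list ns}. v"
  show i: "?i \<in> vertex_maps ns ns"
    using Delta_id joints_le by (force simp: vertex_maps_def)
  have "realize ns ns ?i m x = x" if x: "x \<in> simplices (necklace_sset ns) m" for m x
  proof -
    have D: "decode ns m x \<in> Delta m (sum_list ns)"
      using bead_simplicesD[OF decode_in[OF x]] .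
    show ?thesis
      using realize_in[OF i x] x Delta_le[OF D] D
      by (intro decode_inject[of _ ns m])
        (auto simp: compose_def fun_eq_iff Delta_def PiE_def extensional_def)
  qed
  then show "realize ns ns ?i = (\<lambda>i. \<lambda>x\<in>simplices (necklace_sset ns) i. x)"
    by (auto simp: fun_eq_iff realize_def)
qed

section \<open>Monomorphisms and epimorphisms in terms of vertices\<close>

lemma sset_mono_realize_iff:
  assumes f: "f \<in> vertex_maps ns ms"
  shows "sset_mono (necklace_sset ns) (realize ns ms f) \<longleftrightarrow> inj_on f {..sum_list ns}"
proof
  assume mono: "sset_mono (necklace_sset ns) (realize ns ms f)"
  show "inj_on f {..sum_list ns}"
  proof (rule inj_onI)
    fix u v assume uv: "u \<in> {..sum_list ns}" "v \<in> {..sum_list ns}" "f u = f v"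
    have "u \<le> sum_list ns" "v \<le> sum_list ns" using uv by auto
    note le = this
    from decode_surj[OF vertex_in_bead_simplices[OF le(1)]]
    obtain x where x: "x \<in> simplices (necklace_sset ns) 0" "decode ns 0 x = (\<lambda>i\<in>{..0}. u)" .
    from decode_surj[OF vertex_in_bead_simplices[OF le(2)]]
    obtain y where y: "y \<in> simplices (necklace_sset ns) 0" "decode ns 0 y = (\<lambda>i\<in>{..0}. v)" .
    have "realize ns ms f 0 x = realize ns ms f 0 y"
      using realize_in[OF f x(1)] realize_in[OF f y(1)] x(2) y(2) uv
      by (intro decode_inject[of _ ms 0]) (auto simp: compose_def)
    then have "x = y" using mono x y by (auto simp: sset_mono_def dest: inj_onD)
    then show "u = v" using fun_cong[OF x(2), of 0] fun_cong[OF y(2), of 0] by simp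
  qed
next
  assume inj: "inj_on f {..sum_list ns}"
  show "sset_mono (necklace_sset ns) (realize ns ms f)"
    unfolding sset_mono_def
  proof (intro allI inj_onI)
    fix n x y
    assume x: "x \<in> simplices (necklace_sset ns) n" and y: "y \<in> simplices (necklace_sset ns) n"
      and eq: "realize ns ms f n x = realize ns ms f n y"
    have D: "decode ns n x \<in> Delta n (sum_list ns)" "decode ns n y \<in> Delta n (sum_list ns)"
      using x y by (auto intro: bead_simplicesD decode_in)
    have c: "compose {..n} f (decode ns n x) = compose {..n} f (decode ns n y)"
      using realize_in(2)[OF f x] realize_in(2)[OF f y] eq by simp
    have "decode ns n x i = decode ns n y i" if "i \<le> n" for i
      using fun_cong[OF c, of i] that inj D[THEN Delta_le, OF that]
      by (auto simp: compose_def dest: inj_onD)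
    then show "x = y"
      using D x y by (intro decode_inject[of _ ns n] Delta_eqI[of _ n]) auto
  qed
qed

text \<open>Surjectivity on vertices does not suffice: if a joint went to a non-joint, an edge
  passing over that non-joint would have no lift. Conversely, when joints go to joints, a simplex
  can be lifted vertex by vertex inside a single bead.\<close>

lemma sset_epi_realize_iff:
  assumes f: "f \<in> vertex_maps ns ms"
  shows "sset_epi (necklace_sset ns) (necklace_sset ms) (realize ns ms f) \<longleftrightarrow>
    f ` {..sum_list ns} = {..sum_list ms} \<and> f ` joints ns = joints ms"
    (is "?L \<longleftrightarrow> ?R")
proof
  have D: "f \<in> Delta (sum_list ns) (sum_list ms)" using f by (simp add: vertex_maps_def)
  assume ?L
  have lift: "\<exists>\<sigma> \<in> bead_simplices ns m. \<tau> = compose {..m} f \<sigma>"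
    if \<tau>: "\<tau> \<in> bead_simplices ms m" for \<tau> m
  proof -
    obtain y where "y \<in> simplices (necklace_sset ms) m" "decode ms m y = \<tau>"
      using decode_surj[OF \<tau>] .
    moreover obtain x where "x \<in> simplices (necklace_sset ns) m" "realize ns ms f m x = y"
      using \<open>?L\<close> calculation(1) unfolding sset_epi_def by (metis imageE)
    ultimately show ?thesis
      using realize_in(2)[OF f] decode_in by (intro bexI[of _ "decode ns m x"]) auto
  qed
  have "w \<in> f ` {..sum_list ns}" if w: "w \<le> sum_list ms" for w
  proof -
    obtain \<sigma> where \<sigma>: "\<sigma> \<in> bead_simplices ns 0" "(\<lambda>i\<in>{..0}. w) = compose {..0} f \<sigma>"
      using lift[OF vertex_in_bead_simplices[OF w]] by blast
    have "w = f (\<sigma> 0)" using fun_cong[OF \<sigma>(2), of 0] by (simp add: compose_def)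
    then show ?thesis using Delta_le[OF bead_simplicesD[OF \<sigma>(1)], of 0] by auto
  qed
  then have "f ` {..sum_list ns} = {..sum_list ms}" using Delta_le[OF D] by auto
  moreover have "f t \<in> joints ms" if t: "t \<in> joints ns" for t
  proof (rule ccontr)
    assume not: "f t \<notin> joints ms"
    have tp: "t \<le> sum_list ns" using joints_le[OF t] .
    \<comment> \<open>A non-joint is not an endpoint of the spine, so both neighbours of
      \<open>f t\<close> exist and the truncated subtraction is exact. They span an edge, and any
      lift of it would have to jump over \<open>t\<close>.\<close>
    have "f t \<noteq> 0" "f t \<noteq> sum_list ms" "f t \<le> sum_list ms"
      using not Delta_le[OF D tp] by (metis zero_in_joints sum_list_in_joints)+
    moreover have "s \<le> f t - 1 \<or> f t + 1 \<le> s" if "s \<in> joints ms" for s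
      using that not by (cases "s = f t") auto
    ultimately have "(\<lambda>i\<in>{..1}. if i = 0 then f t - 1 else f t + 1) \<in> bead_simplices ms 1"
      by (intro edge_in_bead_simplices) auto
    from lift[OF this] obtain \<sigma> where \<sigma>: "\<sigma> \<in> bead_simplices ns 1"
      "(\<lambda>i\<in>{..1}. if i = 0 then f t - 1 else f t + 1) = compose {..1} f \<sigma>"
      by blast
    have f\<sigma>: "f (\<sigma> 0) = f t - 1" "f (\<sigma> 1) = f t + 1"
      using fun_cong[OF \<sigma>(2), of 0] fun_cong[OF \<sigma>(2), of 1] by (simp_all add: compose_def)
    have "t \<le> \<sigma> 0 \<or> \<sigma> 1 \<le> t"
      using \<sigma>(1) t by (auto simp: bead_simplices_def)
    moreover have "\<sigma> 0 \<le> sum_list ns"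
      using Delta_le[OF bead_simplicesD[OF \<sigma>(1)]] by simp
    ultimately show False
      using Delta_mono[OF D, of t "\<sigma> 0"] Delta_mono[OF D, of "\<sigma> 1" t] tp \<open>f t \<noteq> 0\<close>
      unfolding f\<sigma> by linarith
  qed
  ultimately show ?R using f by (auto simp: vertex_maps_def)
next
  have D: "f \<in> Delta (sum_list ns) (sum_list ms)" using f by (simp add: vertex_maps_def)
  assume R: ?R
  show ?L
    unfolding sset_epi_def
  proof (intro allI equalityI subsetI)
    fix n y assume "y \<in> realize ns ms f n ` simplices (necklace_sset ns) n"
    then show "y \<in> simplices (necklace_sset ms) n" using realize_in[OF f] by auto
  next
    fix n y assume y: "y \<in> simplices (necklace_sset ms) n"
    define \<tau> where "\<tau> = decode ms n y"
    have \<tau>: "\<tau> \<in> bead_simplices ms n" using decode_in[OF y] by (simp add: \<tau>_def)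
    note D\<tau> = bead_simplicesD[OF \<tau>]
    define J where "J = {t \<in> joints ns. f t \<le> \<tau> 0}"
    define t where "t = Max J"
    have J: "finite J" "0 \<in> J" using f by (simp_all add: J_def vertex_maps_def)
    have "t \<in> J" unfolding t_def using J by (intro Max_in) auto
    then have t: "t \<in> joints ns" "f t \<le> \<tau> 0" by (simp_all add: J_def)
    have t_max: "u \<le> t" if "u \<in> joints ns" "f u \<le> \<tau> 0" for u
      unfolding t_def using that J(1) by (intro Max_ge) (simp_all add: J_def)
    \<comment> \<open>The lift of \<open>\<tau>\<close> starts in the last bead that can carry it, and takes the least preimages
      available there.\<close>
    define P where "P w v \<longleftrightarrow> t \<le> v \<and> w \<le> f v" for w v
    define L where "L w = (LEAST v. P w v)" for w
    have P_top: "P w (sum_list ns)" if "w \<le> sum_list ms" for w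
      using that f joints_le[OF t(1)] by (auto simp: P_def vertex_maps_def)
    have L: "P w (L w)" "L w \<le> sum_list ns" if "w \<le> sum_list ms" for w
      unfolding L_def using P_top[OF that] by (auto intro: LeastI Least_le)
    have fL: "f (L w) = w" if w: "\<tau> 0 \<le> w" "w \<le> sum_list ms" for w
    proof -
      obtain v where v: "v \<le> sum_list ns" "f v = w" using R w by (metis atMost_iff imageE)
      \<comment> \<open>If \<open>v\<close> lies below \<open>t\<close>, monotonicity and
        \<open>f t\<close> \<le> \<open>\<tau> 0\<close> \<le> \<open>w\<close> force
        \<open>f t = w\<close>, so moving up to \<open>t\<close> still gives a preimage of
        \<open>w\<close>.\<close>
      have "f (max t v) = w"
        using v w t(2) Delta_mono[OF D, of v t] joints_le[OF t(1)] by (auto simp: max_def)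
      then have "L w \<le> max t v" unfolding L_def by (intro Least_le) (simp add: P_def)
      then have "f (L w) \<le> w"
        using Delta_mono[OF D, of "L w" "max t v"] \<open>f (max t v) = w\<close> v joints_le[OF t(1)] by simp
      then show ?thesis using L(1)[OF w(2)] by (simp add: P_def)
    qed
    have \<tau>_le: "\<tau> i \<le> sum_list ms" "\<tau> 0 \<le> \<tau> i" if "i \<le> n" for i
      using that Delta_le[OF D\<tau>] Delta_mono[OF D\<tau>] by auto
    define \<sigma> where "\<sigma> = (\<lambda>i\<in>{..n}. L (\<tau> i))"
    have "\<sigma> \<in> Delta n (sum_list ns)"
      unfolding \<sigma>_def
    proof (rule DeltaI)
      fix i j assume ij: "i \<le> j" "j \<le> n"
      then have "P (\<tau> i) (L (\<tau> j))"
        using L(1)[OF \<tau>_le(1)[OF ij(2)]] Delta_mono[OF D\<tau> ij] by (auto simp: P_def)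
      then show "L (\<tau> i) \<le> L (\<tau> j)" unfolding L_def[of "\<tau> i"] by (rule Least_le)
    qed (simp add: L \<tau>_le)
    moreover have "u \<le> \<sigma> 0 \<or> \<sigma> n \<le> u" if u: "u \<in> joints ns" for u
    proof (cases "u \<le> t")
      case True
      then show ?thesis using L(1)[OF \<tau>_le(1), of 0] by (auto simp: \<sigma>_def P_def)
    next
      case False
      \<comment> \<open>By maximality of \<open>t\<close>, the joint \<open>u\<close> maps beyond
        the start of \<tau>. As \<open>f u\<close> is a joint, \<tau> must end before it, so
        \<open>u\<close> is itself a candidate for the least element defining
        \<open>L (\<tau> n)\<close>.\<close>
      then have "\<not> f u \<le> \<tau> 0" using t_max[OF u] by auto
      moreover have "f u \<in> joints ms" using R u by blast
      ultimately have "\<tau> n \<le> f u" using \<tau> by (auto simp: bead_simplices_def)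
      then have "L (\<tau> n) \<le> u"
        unfolding L_def using False by (intro Least_le) (simp add: P_def)
      then show ?thesis by (simp add: \<sigma>_def)
    qed
    ultimately have "\<sigma> \<in> bead_simplices ns n" by (simp add: bead_simplices_def)
    then obtain x where x: "x \<in> simplices (necklace_sset ns) n" "decode ns n x = \<sigma>"
      using decode_surj by blast
    have "compose {..n} f \<sigma> = \<tau>"
      using D\<tau> fL \<tau>_le
      by (auto simp: \<sigma>_def compose_def fun_eq_iff Delta_def PiE_def extensional_def)
    then have "y = realize ns ms f n x"
      using realize_in[OF f x(1)] x(2) y
      by (intro decode_inject[of _ ms n]) (auto simp: \<tau>_def)
    then show "y \<in> realize ns ms f n ` simplices (necklace_sset ns) n" using x(1) by blast
  qed
qed

section \<open>Factorization through the image\<close>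

text \<open>An injective monotone map is the increasing enumeration of its image, so the image
  determines it. This fixes the monic part of a factorization.\<close>

lemma Delta_inj_image_eq:
  assumes g: "g \<in> Delta m n" "inj_on g {..m}" and g': "g' \<in> Delta m' n'" "inj_on g' {..m'}"
    and eq: "g ` {..m} = g' ` {..m'}"
  shows "m = m'" and "g = g'"
proof -
  show m: "m = m'"
    using card_image[OF g(2)] card_image[OF g'(2)] eq by simp
  have sorted: "sorted_wrt (<) (map k [0..<Suc m])"
    if "k \<in> Delta m l" "inj_on k {..m}" for k l
    unfolding sorted_wrt_iff_nth_less
  proof (intro allI impI)
    fix i j assume "i < j" "j < length (map k [0..<Suc m])"
    then have ij: "i < j" "j \<le> m" by simp_all
    then have "k i \<le> k j" "k i \<noteq> k j"
      using Delta_mono[OF that(1), of i j] inj_onD[OF that(2), of i j] by auto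
    then show "map k [0..<Suc m] ! i < map k [0..<Suc m] ! j"
      using ij by (simp del: upt_Suc)
  qed
  have "map g [0..<Suc m] = map g' [0..<Suc m]"
    using sorted[OF g] sorted[of g' n'] g' eq
    by (intro strict_sorted_equal) (auto simp: m atLeast0LessThan lessThan_Suc_atMost simp del: upt_Suc)
  then have "g i = g' i" if "i \<le> m" for i
    using that by (auto simp del: upt_Suc)
  then show "g = g'" using g(1) g'(1) by (auto simp: m intro: Delta_eqI)
qed

lemma Delta_inj_eq_id:
  assumes "f \<in> Delta n n" "inj_on f {..n}"
  shows "f = (\<lambda>i\<in>{..n}. i)"
proof (rule Delta_inj_image_eq(2)[OF assms Delta_id])
  have "f ` {..n} \<subseteq> {..n}" using Delta_le[OF assms(1)] by auto
  then show "f ` {..n} = (\<lambda>i\<in>{..n}. i) ` {..n}"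
    using assms(2) by (simp add: endo_inj_surj)
qed (auto simp: inj_on_def)

text \<open>The middle object has the image of \<open>f\<close> as its spine, renumbered from 0 to
  \<open>r\<close>. Its joints are the images of the joints of \<open>ns\<close>, the choice that
  \<open>sset_epi_realize_iff\<close> demands of the first factor.\<close>

lemma vertex_maps_factor:
  assumes f: "f \<in> vertex_maps ns ms"
  obtains ls h g where "ls \<in> necklaces" "h \<in> vertex_maps ns ls" "g \<in> vertex_maps ls ms"
    "h ` {..sum_list ns} = {..sum_list ls}" "h ` joints ns = joints ls"
    "inj_on g {..sum_list ls}" "f = compose {..sum_list ns} g h"
proof -
  let ?p = "sum_list ns" and ?q = "sum_list ms"
  have D: "f \<in> Delta ?p ?q" and f0: "f 0 = 0" and fp: "f ?p = ?q"
    and fT: "joints ms \<subseteq> f ` joints ns"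
    using f by (auto simp: vertex_maps_def)
  define I where "I = f ` {..?p}"
  \<comment> \<open>The spine [r] has r + 1 vertices, and the image is nonempty.\<close>
  define r where "r = card I - 1"
  have "card I \<noteq> 0" by (auto simp: I_def)
  then have card: "{..<card I} = {..r}" by (auto simp: r_def)
  have "finite I" by (simp add: I_def)
  from ex_bij_betw_strict_mono_card[OF this]
  obtain g0 where g0: "bij_betw g0 {..r} I" "strict_mono_on {..r} g0"
    unfolding card by blast
  define g where "g = (\<lambda>i\<in>{..r}. g0 i)"
  have bij: "bij_betw g {..r} I"
    using g0(1) by (simp add: g_def bij_betw_def inj_on_def)
  have g_less: "g i < g j" if "i < j" "j \<le> r" for i j
    using g0(2) that by (auto simp: g_def strict_mono_on_def)
  have g_le: "i \<le> j" if "g i \<le> g j" "i \<le> r" for i j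
    using that g_less[of j i] by (meson leD le_less_linear)
  have Iq: "I \<subseteq> {..?q}" using Delta_le[OF D] by (auto simp: I_def)
  have gD: "g \<in> Delta r ?q"
    unfolding g_def
  proof (rule DeltaI)
    fix i assume "i \<le> r"
    then show "g0 i \<le> ?q" using bij_betw_apply[OF g0(1), of i] Iq by auto
  next
    fix i j assume "i \<le> j" "j \<le> r"
    then show "g0 i \<le> g0 j" by (intro mono_onD[OF strict_mono_on_imp_mono_on[OF g0(2)]]) simp_all
  qed
  \<comment> \<open>\<open>h v\<close> is the position of \<open>f v\<close> in the increasing
    enumeration \<open>g\<close> of the image.\<close>
  define h where "h = (\<lambda>v\<in>{..?p}. inv_into {..r} g (f v))"
  have h: "h v \<le> r" "g (h v) = f v" if "v \<le> ?p" for v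
  proof -
    have "f v \<in> g ` {..r}" unfolding bij_betw_imp_surj_on[OF bij] using that by (simp add: I_def)
    from inv_into_into[OF this] f_inv_into_f[OF this] show "h v \<le> r" "g (h v) = f v"
      using that by (simp_all add: h_def)
  qed
  have hD: "h \<in> Delta ?p r"
    unfolding h_def
  proof (rule DeltaI)
    fix v assume "v \<le> ?p"
    then show "inv_into {..r} g (f v) \<le> r" using h(1)[of v] by (simp add: h_def)
  next
    fix u v assume uv: "u \<le> v" "v \<le> ?p"
    then have "u \<le> ?p" by simp
    have "h u \<le> h v"
      using Delta_mono[OF D uv]
      by (intro g_le[OF _ h(1)[OF \<open>u \<le> ?p\<close>]]) (simp add: h(2)[OF \<open>u \<le> ?p\<close>] h(2)[OF uv(2)])
    then show "inv_into {..r} g (f u) \<le> inv_into {..r} g (f v)" using uv by (simp add: h_def)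
  qed
  have fh: "f = compose {..?p} g h"
    using D h by (auto simp: fun_eq_iff compose_def Delta_def PiE_def extensional_def)
  have h_onto: "h ` {..?p} = {..r}"
  proof (intro equalityI subsetI)
    fix i assume i: "i \<in> {..r}"
    then have "g i \<in> f ` {..?p}"
      using bij_betw_apply[OF bij] by (simp add: I_def)
    then obtain v where v: "v \<le> ?p" "g i = f v"
      by auto
    then have "i = h v"
      using inj_onD[OF bij_betw_imp_inj_on[OF bij], of i "h v"] h[OF v(1)] i by simp
    then show "i \<in> h ` {..?p}" using v by auto
  qed (use h in auto)
  have h0: "h 0 = 0"
    using g_le[of "h 0" 0] h[of 0] f0 by simp
  have hp: "h ?p = r"
  proof -
    have "r \<in> h ` {..?p}" using h_onto by simp
    then obtain v where "v \<le> ?p" "r = h v" by auto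
    then show ?thesis using Delta_mono[OF hD, of v ?p] h(1)[of ?p] by simp
  qed
  have "0 \<in> h ` joints ns" by (rule image_eqI[of _ _ 0]) (simp_all add: h0)
  then obtain ls where ls: "ls \<in> necklaces" "joints ls = h ` joints ns"
    using ex_joints[OF finite_imageI[OF finite_joints]] by blast
  \<comment> \<open>The spine length of a necklace is its largest joint, so the necklace built from
    these joints has the spine [r].\<close>
  have "Max (h ` joints ns) = r"
  proof (rule Max_eqI)
    show "r \<in> h ` joints ns" by (rule image_eqI[of _ _ ?p]) (simp_all add: hp)
  next
    fix t assume "t \<in> h ` joints ns"
    then show "t \<le> r" using h(1) joints_le by auto
  qed simp
  then have r: "sum_list ls = r" using Max_joints[of ls] ls by simp
  have "h \<in> vertex_maps ns ls"
    using hD h0 hp ls by (simp add: vertex_maps_def r)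
  moreover have "g \<in> vertex_maps ls ms"
  proof -
    \<comment> \<open>The joint condition for \<open>g\<close> is inherited from \<open>f\<close>,
      because \<open>g\<close> sends the joints of \<open>ls\<close> exactly onto the image under
      \<open>f\<close> of the joints of \<open>ns\<close>.\<close>
    have "f ` joints ns = (\<lambda>t. g (h t)) ` joints ns"
      by (rule image_cong) (simp_all add: h(2) joints_le)
    then have "f ` joints ns = g ` joints ls"
      by (simp add: ls(2) image_image)
    moreover have "g 0 = 0" "g r = ?q" using h[of 0] h[of ?p] by (simp_all add: h0 hp f0 fp)
    ultimately show ?thesis using gD fT by (simp add: vertex_maps_def r)
  qed
  ultimately show ?thesis
    using that[OF ls(1) _ _ _ ls(2)[symmetric] _ fh] h_onto bij_betw_imp_inj_on[OF bij]
    by (simp add: r)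
qed

section \<open>The Reedy structure\<close>

abbreviation nec_arr :: "necklace \<Rightarrow> (nat \<Rightarrow> nat) \<Rightarrow> necklace \<Rightarrow> necklace_map" where
  "nec_arr ns f ms \<equiv> (ns, realize ns ms f, ms)"

lemma Obj_Nec: "Obj Nec = necklaces"
  by (simp add: Nec_def)

lemma Dom_Cod_nec_arr [simp]:
  "Dom Nec (nec_arr ns f ms) = ns" "Cod Nec (nec_arr ns f ms) = ms"
  by (simp_all add: Nec_def)

lemma nec_arr_in_Arr:
  "\<lbrakk>ns \<in> necklaces; ms \<in> necklaces; f \<in> vertex_maps ns ms\<rbrakk> \<Longrightarrow> nec_arr ns f ms \<in> Arr Nec"
  by (simp add: Nec_def realize_in_bsset_hom)

text \<open>From here on arrows are handled only through their vertex maps.\<close>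

lemma Arr_NecE:
  assumes "a \<in> Arr Nec"
  obtains ns f ms where "ns \<in> necklaces" "ms \<in> necklaces" "f \<in> vertex_maps ns ms"
    "a = nec_arr ns f ms"
proof -
  obtain ns F ms where "a = (ns, F, ms)" "ns \<in> necklaces" "ms \<in> necklaces"
    "F \<in> bsset_hom (necklace_sset ns) (necklace_sset ms)"
    using assms by (auto simp: Nec_def)
  then show ?thesis using bsset_hom_eq_realize that by blast
qed

lemma Arr_Nec_DomE:
  assumes "a \<in> Arr Nec" "ns = Dom Nec a"
  obtains f ms where "ms \<in> necklaces" "f \<in> vertex_maps ns ms" "a = nec_arr ns f ms"
proof -
  obtain ns' f ms where a: "ms \<in> necklaces" "f \<in> vertex_maps ns' ms" "a = nec_arr ns' f ms"
    using assms(1) by (rule Arr_NecE)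
  moreover have "ns' = ns" using assms(2) by (simp add: a(3))
  ultimately show ?thesis using that by simp
qed

lemma Id_Nec: "Id Nec ns = nec_arr ns (\<lambda>v\<in>{..sum_list ns}. v) ns"
  by (simp add: Nec_def realize_id)

lemma Comp_Nec:
  "\<lbrakk>f \<in> vertex_maps ns ms; g \<in> vertex_maps ms ls\<rbrakk> \<Longrightarrow>
    Comp Nec (nec_arr ms g ls) (nec_arr ns f ms) = nec_arr ns (compose {..sum_list ns} g f) ls"
  by (simp add: Nec_def realize_compose)

lemma nec_arr_in_Nec_epis_iff:
  assumes "ns \<in> necklaces" "ms \<in> necklaces" "f \<in> vertex_maps ns ms"
  shows "nec_arr ns f ms \<in> Nec_epis \<longleftrightarrow>
    f ` {..sum_list ns} = {..sum_list ms} \<and> f ` joints ns = joints ms"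
  using nec_arr_in_Arr[OF assms] assms(3) by (simp add: Nec_epis_def sset_epi_realize_iff)

lemma nec_arr_in_Nec_monos_iff:
  assumes "ns \<in> necklaces" "ms \<in> necklaces" "f \<in> vertex_maps ns ms"
  shows "nec_arr ns f ms \<in> Nec_monos \<longleftrightarrow> inj_on f {..sum_list ns}"
  using nec_arr_in_Arr[OF assms] assms(3) by (simp add: Nec_monos_def sset_mono_realize_iff)

lemma vertex_mapsD: "f \<in> vertex_maps ns ms \<Longrightarrow> f \<in> Delta (sum_list ns) (sum_list ms)"
  by (simp add: vertex_maps_def)

section \<open>The category of necklaces and its two wide subcategories\<close>

lemma category_Nec: "category Nec"
proof
  fix f assume "f \<in> Arr Nec"
  then obtain ns u ms where f: "ns \<in> necklaces" "ms \<in> necklaces" "u \<in> vertex_maps ns ms"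
    "f = nec_arr ns u ms"
    by (rule Arr_NecE)
  then show "Dom Nec f \<in> Obj Nec" "Cod Nec f \<in> Obj Nec"
    by (simp_all add: Obj_Nec)
  have u: "u \<in> {..sum_list ns} \<rightarrow>\<^sub>E {..sum_list ms}"
    using vertex_mapsD[OF f(3)] by (simp add: Delta_def)
  then have "compose {..sum_list ns} u (\<lambda>v\<in>{..sum_list ns}. v) = u"
    "compose {..sum_list ns} (\<lambda>v\<in>{..sum_list ms}. v) u = u"
    by (auto simp: PiE_def intro!: compose_Id Id_compose)
  then show "Comp Nec f (Id Nec (Dom Nec f)) = f" "Comp Nec (Id Nec (Cod Nec f)) f = f"
    using f realize_id(1) by (simp_all add: Id_Nec Comp_Nec)
  fix g assume "g \<in> Arr Nec" "Cod Nec f = Dom Nec g"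
  then obtain v ls where g: "ls \<in> necklaces" "v \<in> vertex_maps ms ls" "g = nec_arr ms v ls"
    unfolding f(4) Dom_Cod_nec_arr by (rule Arr_Nec_DomE)
  then show "Comp Nec g f \<in> Arr Nec" "Dom Nec (Comp Nec g f) = Dom Nec f"
    "Cod Nec (Comp Nec g f) = Cod Nec g"
    using f realize_compose(1)[OF f(3) g(2)] by (simp_all add: Comp_Nec nec_arr_in_Arr)
  fix h assume "h \<in> Arr Nec" "Cod Nec g = Dom Nec h"
  then obtain w ks where h: "ks \<in> necklaces" "w \<in> vertex_maps ls ks" "h = nec_arr ls w ks"
    unfolding g(3) Dom_Cod_nec_arr by (rule Arr_Nec_DomE)
  have "compose {..sum_list ns} w (compose {..sum_list ns} v u)
      = compose {..sum_list ns} (compose {..sum_list ms} w v) u"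
    using u by (intro compose_assoc) auto
  then show "Comp Nec h (Comp Nec g f) = Comp Nec (Comp Nec h g) f"
    using f g h by (simp add: Comp_Nec realize_compose(1))
qed (auto simp: Obj_Nec Id_Nec nec_arr_in_Arr realize_id(1))

lemma wide_subcategory_Nec_epis: "wide_subcategory Nec Nec_epis"
proof (intro wide_subcategory.intro category_Nec wide_subcategory_axioms.intro)
  show sub: "Nec_epis \<subseteq> Arr Nec" by (auto simp: Nec_epis_def)
  show "Id Nec a \<in> Nec_epis" if "a \<in> Obj Nec" for a
  proof -
    have "(\<lambda>v\<in>{..sum_list a}. v) ` joints a = joints a" by (force simp: joints_le)
    then show ?thesis
      using that by (simp add: Obj_Nec Id_Nec nec_arr_in_Nec_epis_iff realize_id(1))
  qed
  show "Comp Nec g f \<in> Nec_epis" if fg: "f \<in> Nec_epis" "g \<in> Nec_epis" "Cod Nec f = Dom Nec g" for f g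
  proof -
    obtain ns u ms where f: "ns \<in> necklaces" "ms \<in> necklaces" "u \<in> vertex_maps ns ms"
      "f = nec_arr ns u ms"
      using subsetD[OF sub fg(1)] by (rule Arr_NecE)
    obtain v ls where g: "ls \<in> necklaces" "v \<in> vertex_maps ms ls" "g = nec_arr ms v ls"
      using subsetD[OF sub fg(2)] fg(3) unfolding f(4) Dom_Cod_nec_arr by (rule Arr_Nec_DomE)
    have "u ` {..sum_list ns} = {..sum_list ms}" "u ` joints ns = joints ms"
      "v ` {..sum_list ms} = {..sum_list ls}" "v ` joints ms = joints ls"
      using fg(1,2) f g by (simp_all add: nec_arr_in_Nec_epis_iff)
    moreover have "compose {..sum_list ns} v u ` A = v ` u ` A" if "A \<subseteq> {..sum_list ns}" for A
      using that by (auto simp: compose_def image_image)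
    moreover have "joints ns \<subseteq> {..sum_list ns}" by (auto simp: joints_le)
    ultimately show ?thesis
      using f g realize_compose(1)[OF f(3) g(2)] by (simp add: Comp_Nec nec_arr_in_Nec_epis_iff)
  qed
qed

lemma wide_subcategory_Nec_monos: "wide_subcategory Nec Nec_monos"
proof (intro wide_subcategory.intro category_Nec wide_subcategory_axioms.intro)
  show sub: "Nec_monos \<subseteq> Arr Nec" by (auto simp: Nec_monos_def)
  show "Id Nec a \<in> Nec_monos" if "a \<in> Obj Nec" for a
    using that by (simp add: Obj_Nec Id_Nec nec_arr_in_Nec_monos_iff realize_id(1) inj_on_def)
  show "Comp Nec g f \<in> Nec_monos" if fg: "f \<in> Nec_monos" "g \<in> Nec_monos" "Cod Nec f = Dom Nec g" for f g
  proof -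
    obtain ns u ms where f: "ns \<in> necklaces" "ms \<in> necklaces" "u \<in> vertex_maps ns ms"
      "f = nec_arr ns u ms"
      using subsetD[OF sub fg(1)] by (rule Arr_NecE)
    obtain v ls where g: "ls \<in> necklaces" "v \<in> vertex_maps ms ls" "g = nec_arr ms v ls"
      using subsetD[OF sub fg(2)] fg(3) unfolding f(4) Dom_Cod_nec_arr by (rule Arr_Nec_DomE)
    have "inj_on u {..sum_list ns}" "inj_on v {..sum_list ms}"
      using fg(1,2) f g by (simp_all add: nec_arr_in_Nec_monos_iff)
    then have "inj_on (compose {..sum_list ns} v u) {..sum_list ns}"
      using Delta_le[OF vertex_mapsD[OF f(3)]] by (auto simp: inj_on_def compose_def)
    then show ?thesis
      using f g realize_compose(1)[OF f(3) g(2)] by (simp add: Comp_Nec nec_arr_in_Nec_monos_iff)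
  qed
qed

text \<open>Since \<open>h\<close> is onto, \<open>g\<close> has the same image as the composite,
  and so does \<open>g'\<close>; hence they are equal. Cancelling the injective \<open>g\<close>
  gives \<open>h = h'\<close>, and then both middle objects have the joints \<open>h\<close> takes
  on, which determine them.\<close>

lemma vertex_maps_factor_unique:
  assumes g: "g \<in> vertex_maps ls ms" "inj_on g {..sum_list ls}"
    and g': "g' \<in> vertex_maps ls' ms" "inj_on g' {..sum_list ls'}"
    and h: "h \<in> vertex_maps ns ls" "h ` {..sum_list ns} = {..sum_list ls}" "h ` joints ns = joints ls"
    and h': "h' \<in> vertex_maps ns ls'" "h' ` {..sum_list ns} = {..sum_list ls'}"
      "h' ` joints ns = joints ls'"
    and ls: "ls \<in> necklaces" "ls' \<in> necklaces"
    and eq: "compose {..sum_list ns} g h = compose {..sum_list ns} g' h'"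
  shows "ls = ls'" "g = g'" "h = h'"
proof -
  have "g ` {..sum_list ls} = compose {..sum_list ns} g h ` {..sum_list ns}"
    by (simp add: compose_def image_image flip: h(2))
  moreover have "g' ` {..sum_list ls'} = compose {..sum_list ns} g' h' ` {..sum_list ns}"
    by (simp add: compose_def image_image flip: h'(2))
  ultimately have im: "g ` {..sum_list ls} = g' ` {..sum_list ls'}" by (simp add: eq)
  note gg = Delta_inj_image_eq[OF vertex_mapsD[OF g(1)] g(2) vertex_mapsD[OF g'(1)] g'(2) im]
  show "g = g'" by (rule gg)
  show "h = h'"
  proof (rule Delta_eqI[OF vertex_mapsD[OF h(1)] vertex_mapsD[OF h'(1)]])
    fix v assume v: "v \<le> sum_list ns"
    then have "g (h v) = g (h' v)"
      using fun_cong[OF eq, of v] gg by (simp add: compose_def)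
    moreover have "h v \<le> sum_list ls" "h' v \<le> sum_list ls"
      using v Delta_le[OF vertex_mapsD[OF h(1)]] Delta_le[OF vertex_mapsD[OF h'(1)]] gg by auto
    ultimately show "h v = h' v" using g(2) by (auto dest: inj_onD)
  qed
  then show "ls = ls'" using h(3) h'(3) ls by (auto intro: joints_inject)
qed

section \<open>Change of the degree\<close>

lemma card_joints_add_nec_dim:
  assumes "ns \<in> necklaces"
  shows "card (joints ns) + nec_dim ns = Suc (sum_list ns)"
  using card_joints[OF assms] length_le_sum_list[OF assms]
  by (simp add: nec_dim_def spine_length_def bead_length_def)

text \<open>The case of stationary degree: an injective monotone map between spines of equal length
  is the identity on vertices, so the two necklaces have the same joints and coincide.\<close>

lemma vertex_map_eq_id:
  assumes "ns \<in> necklaces" "ms \<in> necklaces" "f \<in> vertex_maps ns ms"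
    and "inj_on f {..sum_list ns}" "sum_list ns = sum_list ms" "f ` joints ns = joints ms"
  shows "nec_arr ns f ms = Id Nec ns"
proof -
  have "f = (\<lambda>v\<in>{..sum_list ns}. v)"
    using assms vertex_mapsD[of f ns ms] by (intro Delta_inj_eq_id) auto
  moreover from this have "joints ns = joints ms"
    using assms(6) joints_le by force
  ultimately show ?thesis using joints_inject[OF assms(1,2)] by (simp add: Id_Nec)
qed

text \<open>Each non-joint of the codomain has a preimage, which cannot be a joint, so the dimension
  does not grow; nor does the number of joints. If both stay the same, the spines have equal length
  and surjectivity becomes bijectivity. The second component is needed: collapsing
  \<open>[1]\<close> to \<open>[]\<close> keeps the dimension 0.\<close>

lemma Nec_epis_lower:
  assumes a: "a \<in> Nec_epis" "a \<noteq> Id Nec (Dom Nec a)"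
  shows "nec_deg (Cod Nec a) < nec_deg (Dom Nec a)"
proof -
  have "a \<in> Arr Nec" using a by (auto simp: Nec_epis_def)
  then obtain ns f ms where f: "ns \<in> necklaces" "ms \<in> necklaces" "f \<in> vertex_maps ns ms"
    and a_eq: "a = nec_arr ns f ms"
    by (rule Arr_NecE)
  then have epi: "f ` {..sum_list ns} = {..sum_list ms}" "f ` joints ns = joints ms"
    using a(1) by (simp_all add: nec_arr_in_Nec_epis_iff)
  have "{..sum_list ms} - joints ms \<subseteq> f ` ({..sum_list ns} - joints ns)"
    using epi by blast
  then have dim: "nec_dim ms \<le> nec_dim ns"
    unfolding nec_dim_eq_card[OF f(1)] nec_dim_eq_card[OF f(2)] by (intro surj_card_le) auto
  have card: "card (joints ms) \<le> card (joints ns)"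
    unfolding epi(2)[symmetric] by (rule card_image_le) simp
  have "\<not> (nec_dim ms = nec_dim ns \<and> card (joints ms) = card (joints ns))"
  proof
    assume "nec_dim ms = nec_dim ns \<and> card (joints ms) = card (joints ns)"
    then have eq: "sum_list ns = sum_list ms"
      using card_joints_add_nec_dim[OF f(1)] card_joints_add_nec_dim[OF f(2)] by simp
    then have "inj_on f {..sum_list ns}" using epi(1) by (intro eq_card_imp_inj_on) auto
    then have "nec_arr ns f ms = Id Nec ns" using vertex_map_eq_id[OF f] eq epi(2) by simp
    then show False using a(2) unfolding a_eq Dom_Cod_nec_arr by simp
  qed
  then show ?thesis
    using dim card card_joints[OF f(1)] card_joints[OF f(2)]
    by (auto simp: a_eq nec_deg_def bead_length_def less_prod_def)
qed

text \<open>All joints of the codomain are images of joints, so injectivity sends non-joints to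
  non-joints. Here the dimension alone already increases strictly.\<close>

lemma Nec_monos_raise:
  assumes a: "a \<in> Nec_monos" "a \<noteq> Id Nec (Dom Nec a)"
  shows "nec_deg (Dom Nec a) < nec_deg (Cod Nec a)"
proof -
  have "a \<in> Arr Nec" using a by (auto simp: Nec_monos_def)
  then obtain ns f ms where f: "ns \<in> necklaces" "ms \<in> necklaces" "f \<in> vertex_maps ns ms"
    and a_eq: "a = nec_arr ns f ms"
    by (rule Arr_NecE)
  then have inj: "inj_on f {..sum_list ns}"
    using a(1) by (simp add: nec_arr_in_Nec_monos_iff)
  let ?N = "{..sum_list ns} - joints ns" and ?M = "{..sum_list ms} - joints ms"
  have T: "joints ms \<subseteq> f ` joints ns" using f(3) by (simp add: vertex_maps_def)
  have disj: "f ` ?N \<inter> f ` joints ns = {}"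
    using inj joints_le by (fastforce dest: inj_onD)
  have sub: "f ` ?N \<subseteq> ?M"
    using disj T Delta_le[OF vertex_mapsD[OF f(3)]] by auto
  have cardN: "card (f ` ?N) = card ?N"
    using inj by (intro card_image) (auto intro: inj_on_subset)
  have "nec_dim ns \<le> nec_dim ms"
    unfolding nec_dim_eq_card[OF f(1)] nec_dim_eq_card[OF f(2)] cardN[symmetric]
    using sub by (intro card_mono) auto
  moreover have "nec_dim ns \<noteq> nec_dim ms"
  proof
    assume eq: "nec_dim ns = nec_dim ms"
    \<comment> \<open>With equal dimensions the non-joints of the codomain are used up by images of
      non-joints, so joints can only land on joints. Equal numbers of joints and of non-joints then
      give spines of equal length.\<close>
    then have "f ` ?N = ?M"
      using sub cardN unfolding nec_dim_eq_card[OF f(1)] nec_dim_eq_card[OF f(2)]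
      by (intro card_subset_eq) auto
    moreover have "f ` joints ns \<subseteq> {..sum_list ms}"
      using Delta_le[OF vertex_mapsD[OF f(3)]] joints_le by auto
    ultimately have J: "f ` joints ns = joints ms" using disj T by blast
    have "card (f ` joints ns) = card (joints ns)"
      using inj joints_le by (intro card_image) (auto intro: inj_on_subset)
    then have "sum_list ns = sum_list ms"
      using card_joints_add_nec_dim[OF f(1)] card_joints_add_nec_dim[OF f(2)] eq J by simp
    then have "nec_arr ns f ms = Id Nec ns" using vertex_map_eq_id[OF f inj _ J] by simp
    then show False using a(2) unfolding a_eq Dom_Cod_nec_arr by simp
  qed
  ultimately show ?thesis by (simp add: a_eq nec_deg_def less_prod_def)
qed

lemma Nec_unique_factorization:
  assumes "a \<in> Arr Nec"
  shows "\<exists>!(g, h). g \<in> Nec_monos \<and> h \<in> Nec_epis \<and> Cod Nec h = Dom Nec g \<and> a = Comp Nec g h"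
proof -
  obtain ns f ms where f: "ns \<in> necklaces" "ms \<in> necklaces" "f \<in> vertex_maps ns ms"
    and a: "a = nec_arr ns f ms"
    using assms by (rule Arr_NecE)
  obtain ls h g where ls: "ls \<in> necklaces" and h: "h \<in> vertex_maps ns ls"
      "h ` {..sum_list ns} = {..sum_list ls}" "h ` joints ns = joints ls"
    and g: "g \<in> vertex_maps ls ms" "inj_on g {..sum_list ls}"
    and gh: "f = compose {..sum_list ns} g h"
    using vertex_maps_factor[OF f(3)] by metis
  have unique: "G = nec_arr ls g ms \<and> H = nec_arr ns h ls"
    if GH: "G \<in> Nec_monos" "H \<in> Nec_epis" "Cod Nec H = Dom Nec G" "a = Comp Nec G H" for G H
  proof -
    have Arr: "H \<in> Arr Nec" "G \<in> Arr Nec"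
      using GH(1,2) wide_subcategory.sub_Arr[OF wide_subcategory_Nec_epis]
        wide_subcategory.sub_Arr[OF wide_subcategory_Nec_monos] by blast+
    obtain ns' h' ls' where H: "ns' \<in> necklaces" "ls' \<in> necklaces"
      "h' \<in> vertex_maps ns' ls'" "H = nec_arr ns' h' ls'"
      using Arr(1) by (rule Arr_NecE)
    obtain g' ms' where G: "ms' \<in> necklaces" "g' \<in> vertex_maps ls' ms'" "G = nec_arr ls' g' ms'"
      using Arr(2) GH(3) unfolding H(4) Dom_Cod_nec_arr by (rule Arr_Nec_DomE)
    have eq: "ns' = ns" "ms' = ms"
      "realize ns ms f = realize ns ms (compose {..sum_list ns} g' h')"
      using GH(4) unfolding a H(4) G(3) Comp_Nec[OF H(3) G(2)] by auto
    note h' = H(3)[unfolded eq] and g' = G(2)[unfolded eq]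
    \<comment> \<open>Faithfulness of \<open>realize\<close> turns the equation of simplicial maps
      into one of vertex maps, where the combinatorial uniqueness applies.\<close>
    have "f = compose {..sum_list ns} g' h'"
      using f(3) realize_compose(1)[OF h' g'] eq(3) by (rule realize_inject)
    then have gh': "compose {..sum_list ns} g h = compose {..sum_list ns} g' h'" using gh by simp
    have "inj_on g' {..sum_list ls'}"
      using GH(1) unfolding G(3) eq nec_arr_in_Nec_monos_iff[OF H(2) f(2) g'] .
    moreover have "h' ` {..sum_list ns} = {..sum_list ls'} \<and> h' ` joints ns = joints ls'"
      using GH(2) unfolding H(4) eq nec_arr_in_Nec_epis_iff[OF f(1) H(2) h'] .
    ultimately have "ls = ls'" "g = g'" "h = h'"
      using vertex_maps_factor_unique[OF g g' _ h h' _ _ ls H(2) gh'] by simp_all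
    then show ?thesis using G H eq by simp
  qed
  show ?thesis
  proof (rule ex1I[of _ "(nec_arr ls g ms, nec_arr ns h ls)"])
    show "case (nec_arr ls g ms, nec_arr ns h ls) of (g, h) \<Rightarrow>
        g \<in> Nec_monos \<and> h \<in> Nec_epis \<and> Cod Nec h = Dom Nec g \<and> a = Comp Nec g h"
      using f ls g h
      by (simp add: a gh Comp_Nec nec_arr_in_Nec_epis_iff nec_arr_in_Nec_monos_iff)
  qed (use unique in blast)
qed

theorem theorem3p21:
  shows "reedy_category Nec Nec_epis Nec_monos nec_deg"
  by (intro reedy_category.intro reedy_category_axioms.intro category_Nec wide_subcategory_Nec_epis
      wide_subcategory_Nec_monos Nec_unique_factorization Nec_epis_lower Nec_monos_raise)

end
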